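(* For any natural number $n$, the variety of singular $n\times n$-matrices, i.e. the closed subvariety $\{M\in T^{n\times n} : \det M=0\}$ of the torus $T^{n\times n}\cong T^{n^2}$, is tropically unirational.
   Context: $K$ is an algebraically closed field with a non-Archimedean valuation $v:K\to\mathbb{R}\cup\{\infty\}$ (possibly trivial). Write $T=K^*$ for the one-dimensional torus over $K$ and $T^n$ for the $n$-dimensional torus; $T^{n\times n}$ is the torus of $n\times n$-matrices with all entries non-zero. For a non-zero polynomial (or Laurent polynomial) $f=\sum_\alpha c_\alpha x^\alpha$ in $m$ variables over $K$, $\operatorname{Trop}(f):\mathbb{R}^m\to\mathbb{R}$ is the function $\operatorname{Trop}(f)(\xi)=\min_\alpha (v(c_\alpha)+\xi\cdot\alpha)$. It extends to non-zero rational functions by $\operatorname{Trop}(f/h)=\operatorname{Trop}(f)-\operatorname{Trop}(h)$. For a rational map $\varphi=(f_1,\ldots,f_n):T^m\dashrightarrow T^n$ (each $f_i$ a non-zero rational function) set $\operatorname{Trop}(\varphi)=(\operatorname{Trop}(f_1),\ldots,\operatorname{Trop}(f_n)):\mathbb{R}^m\to\mathbb{R}^n$. For a closed subvariety $X\subseteq T^n$, $\operatorname{Trop}(X)\subseteq\mathbb{R}^n$ is the intersection of the corner loci of $\operatorname{Trop}(f)$ (the sets where the minimum is attained at least twice) over all $f$ in the ideal of $X$ in $K[x_1^{\pm1},\ldots,x_n^{\pm1}]$. A closed subvariety $X\subseteq T^n$ is called tropically unirational if there exist a natural number $p$ and a dominant rational map $\varphi:T^p\dashrightarrow X$ such that 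$\operatorname{im}\operatorname{Trop}(\varphi)=\operatorname{Trop}(X)$.
   Formalization: Stated for n ≥ 2 instead of any natural number n: for n = 0 and n = 1 the variety of singular matrices in the torus is empty, so its tropicalization is empty and cannot equal the non-empty image of Trop(φ). *)

theory Defs
  imports
    "HOL-Library.Poly_Mapping"
    "HOL-Library.FuncSet"
    "HOL-Library.Extended_Real"
    "HOL-Computational_Algebra.Fraction_Field"
    "Jordan_Normal_Form.Determinant"
begin

text \<open>Coordinates are indexed by a finite set \<open>I\<close> (\<open>{..<p}\<close> for \<open>T\<^sup>p\<close>,
  \<open>{..<n} \<times> {..<n}\<close> for the matrix torus); points of \<open>T\<^sup>I\<close> and \<open>\<real>\<^sup>I\<close> are extensional
  functions on \<open>I\<close>, so that equality of points is equality of their \<open>I\<close>-coordinates.\<close>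

definition nonarch_valuation :: "('k::field \<Rightarrow> ereal) \<Rightarrow> bool" where
  "nonarch_valuation v \<longleftrightarrow>
     (\<forall>x. v x \<noteq> -\<infinity>) \<and>
     (\<forall>x. v x = \<infinity> \<longleftrightarrow> x = 0) \<and>
     (\<forall>x y. v (x * y) = v x + v y) \<and>
     (\<forall>x y. min (v x) (v y) \<le> v (x + y))"

definition torus :: "'i set \<Rightarrow> ('i \<Rightarrow> 'k::zero) set" where
  "torus I = I \<rightarrow>\<^sub>E (- {0})"


subsection \<open>Laurent polynomials\<close>

text \<open>A Laurent polynomial maps exponent vectors to coefficients.\<close>

type_synonym ('i, 'k) laurent = "('i \<Rightarrow>\<^sub>0 int) \<Rightarrow>\<^sub>0 'k"

definition laurent_polys :: "'i set \<Rightarrow> ('i, 'k::zero) laurent set" where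
  "laurent_polys I = {f. \<forall>\<alpha>\<in>Poly_Mapping.keys f. Poly_Mapping.keys \<alpha> \<subseteq> I}"

definition monom_eval :: "('i \<Rightarrow>\<^sub>0 int) \<Rightarrow> ('i \<Rightarrow> 'k::field) \<Rightarrow> 'k" where
  "monom_eval \<alpha> x = (\<Prod>i\<in>Poly_Mapping.keys \<alpha>. x i powi Poly_Mapping.lookup \<alpha> i)"

definition laurent_eval :: "('i, 'k::field) laurent \<Rightarrow> ('i \<Rightarrow> 'k) \<Rightarrow> 'k" where
  "laurent_eval f x =
     (\<Sum>\<alpha>\<in>Poly_Mapping.keys f. Poly_Mapping.lookup f \<alpha> * monom_eval \<alpha> x)"

definition vanishing_ideal :: "'i set \<Rightarrow> ('i \<Rightarrow> 'k::field) set \<Rightarrow> ('i, 'k) laurent set" where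
  "vanishing_ideal I X = {f \<in> laurent_polys I. \<forall>x\<in>X. laurent_eval f x = 0}"

definition zero_locus :: "'i set \<Rightarrow> ('i, 'k::field) laurent set \<Rightarrow> ('i \<Rightarrow> 'k) set" where
  "zero_locus I F = {x \<in> torus I. \<forall>f\<in>F. laurent_eval f x = 0}"

definition closed_subvariety :: "'i set \<Rightarrow> ('i \<Rightarrow> 'k::field) set \<Rightarrow> bool" where
  "closed_subvariety I X \<longleftrightarrow> (\<exists>F \<subseteq> laurent_polys I. X = zero_locus I F)"

definition zariski_closure :: "'i set \<Rightarrow> ('i \<Rightarrow> 'k::field) set \<Rightarrow> ('i \<Rightarrow> 'k) set" where
  "zariski_closure I S = zero_locus I (vanishing_ideal I S)"


subsection \<open>Tropicalization of Laurent polynomials and of varieties\<close>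

definition exponent_pairing :: "('i \<Rightarrow> real) \<Rightarrow> ('i \<Rightarrow>\<^sub>0 int) \<Rightarrow> real" where
  "exponent_pairing \<xi> \<alpha> =
     (\<Sum>i\<in>Poly_Mapping.keys \<alpha>. \<xi> i * of_int (Poly_Mapping.lookup \<alpha> i))"

definition term_weight ::
  "('k::field \<Rightarrow> ereal) \<Rightarrow> ('i, 'k) laurent \<Rightarrow> ('i \<Rightarrow> real) \<Rightarrow> ('i \<Rightarrow>\<^sub>0 int) \<Rightarrow> real" where
  "term_weight v f \<xi> \<alpha> =
     real_of_ereal (v (Poly_Mapping.lookup f \<alpha>)) + exponent_pairing \<xi> \<alpha>"

text \<open>Only used for \<open>f \<noteq> 0\<close>. Terms with coefficient \<open>0\<close> have weight \<open>\<infinity>\<close>, so the minimum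
  is taken over the support of \<open>f\<close>, where \<open>v\<close> is finite.\<close>

definition trop_poly ::
  "('k::field \<Rightarrow> ereal) \<Rightarrow> ('i, 'k) laurent \<Rightarrow> ('i \<Rightarrow> real) \<Rightarrow> real" where
  "trop_poly v f \<xi> = Min (term_weight v f \<xi> ` Poly_Mapping.keys f)"

definition corner_locus ::
  "('k::field \<Rightarrow> ereal) \<Rightarrow> 'i set \<Rightarrow> ('i, 'k) laurent \<Rightarrow> ('i \<Rightarrow> real) set" where
  "corner_locus v I f =
     {\<xi> \<in> I \<rightarrow>\<^sub>E UNIV. \<exists>\<alpha>\<in>Poly_Mapping.keys f. \<exists>\<beta>\<in>Poly_Mapping.keys f. \<alpha> \<noteq> \<beta> \<and>
        term_weight v f \<xi> \<alpha> = trop_poly v f \<xi> \<and> term_weight v f \<xi> \<beta> = trop_poly v f \<xi>}"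

text \<open>The zero polynomial imposes no condition; the intersection is taken inside \<open>\<real>\<^sup>I\<close>.\<close>

definition trop_variety ::
  "('k::field \<Rightarrow> ereal) \<Rightarrow> 'i set \<Rightarrow> ('i \<Rightarrow> 'k) set \<Rightarrow> ('i \<Rightarrow> real) set" where
  "trop_variety v I X =
     (I \<rightarrow>\<^sub>E UNIV) \<inter> (\<Inter>f \<in> vanishing_ideal I X - {0}. corner_locus v I f)"


subsection \<open>Rational functions and rational maps\<close>

text \<open>Rational functions on \<open>T\<^sup>J\<close> are elements of the fraction field of the Laurent polynomial
  ring; fractions are always taken with numerator and denominator in the variables from \<open>J\<close>.
  The linear order on the variables only serves to make the ring an instance of class
  \<open>idom\<close>.\<close>

definition is_fraction ::
  "'j::linorder set \<Rightarrow> ('j, 'k::field) laurent fract \<Rightarrow> ('j, 'k) laurent \<Rightarrow> ('j, 'k) laurent \<Rightarrow> bool"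
  where
  "is_fraction J r f h \<longleftrightarrow>
     f \<in> laurent_polys J \<and> h \<in> laurent_polys J \<and> h \<noteq> 0 \<and> r = Fract f h"

definition rational_functions :: "'j::linorder set \<Rightarrow> ('j, 'k::field) laurent fract set" where
  "rational_functions J = {r. \<exists>f h. is_fraction J r f h}"

definition regular_at ::
  "'j::linorder set \<Rightarrow> ('j, 'k::field) laurent fract \<Rightarrow> ('j \<Rightarrow> 'k) \<Rightarrow> bool" where
  "regular_at J r x \<longleftrightarrow> (\<exists>f h. is_fraction J r f h \<and> laurent_eval h x \<noteq> 0)"

text \<open>The value of \<open>r\<close> at a point, and below its tropicalization, do not depend on the chosen
  fraction: see \<open>ratfun_eval_eq\<close> and \<open>trop_ratfun_eq\<close>.\<close>

definition ratfun_eval ::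
  "'j::linorder set \<Rightarrow> ('j, 'k::field) laurent fract \<Rightarrow> ('j \<Rightarrow> 'k) \<Rightarrow> 'k" where
  "ratfun_eval J r x =
     (THE c. \<exists>f h. is_fraction J r f h \<and> laurent_eval h x \<noteq> 0 \<and>
        c = laurent_eval f x / laurent_eval h x)"

definition trop_ratfun ::
  "('k::field \<Rightarrow> ereal) \<Rightarrow> 'j::linorder set \<Rightarrow> ('j, 'k) laurent fract \<Rightarrow> ('j \<Rightarrow> real) \<Rightarrow> real" where
  "trop_ratfun v J r \<xi> =
     (THE c. \<exists>f h. is_fraction J r f h \<and> f \<noteq> 0 \<and> c = trop_poly v f \<xi> - trop_poly v h \<xi>)"

definition rational_map ::
  "'j::linorder set \<Rightarrow> 'i set \<Rightarrow> ('i \<Rightarrow> ('j, 'k::field) laurent fract) \<Rightarrow> bool" where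
  "rational_map J I \<phi> \<longleftrightarrow> (\<forall>i\<in>I. \<phi> i \<in> rational_functions J - {0})"

text \<open>A point maps into \<open>T\<^sup>I\<close> iff all components are regular and non-zero there.\<close>

definition ratmap_domain ::
  "'j::linorder set \<Rightarrow> 'i set \<Rightarrow> ('i \<Rightarrow> ('j, 'k::field) laurent fract) \<Rightarrow> ('j \<Rightarrow> 'k) set" where
  "ratmap_domain J I \<phi> =
     {x \<in> torus J. \<forall>i\<in>I. regular_at J (\<phi> i) x \<and> ratfun_eval J (\<phi> i) x \<noteq> 0}"

definition ratmap_eval ::
  "'j::linorder set \<Rightarrow> 'i set \<Rightarrow> ('i \<Rightarrow> ('j, 'k::field) laurent fract) \<Rightarrow> ('j \<Rightarrow> 'k) \<Rightarrow> 'i \<Rightarrow> 'k" where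
  "ratmap_eval J I \<phi> x = (\<lambda>i\<in>I. ratfun_eval J (\<phi> i) x)"

definition dominant_rational_map ::
  "'j::linorder set \<Rightarrow> 'i set \<Rightarrow> ('i \<Rightarrow> 'k::field) set \<Rightarrow> ('i \<Rightarrow> ('j, 'k) laurent fract) \<Rightarrow> bool" where
  "dominant_rational_map J I X \<phi> \<longleftrightarrow>
     rational_map J I \<phi> \<and>
     ratmap_eval J I \<phi> ` ratmap_domain J I \<phi> \<subseteq> X \<and>
     zariski_closure I (ratmap_eval J I \<phi> ` ratmap_domain J I \<phi>) = X"

definition trop_map ::
  "('k::field \<Rightarrow> ereal) \<Rightarrow> 'j::linorder set \<Rightarrow> 'i set \<Rightarrow> ('i \<Rightarrow> ('j, 'k) laurent fract)
     \<Rightarrow> ('j \<Rightarrow> real) \<Rightarrow> 'i \<Rightarrow> real" where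
  "trop_map v J I \<phi> \<xi> = (\<lambda>i\<in>I. trop_ratfun v J (\<phi> i) \<xi>)"

definition tropically_unirational ::
  "('k::field \<Rightarrow> ereal) \<Rightarrow> 'i set \<Rightarrow> ('i \<Rightarrow> 'k) set \<Rightarrow> bool" where
  "tropically_unirational v I X \<longleftrightarrow>
     closed_subvariety I X \<and>
     (\<exists>(p::nat) \<phi>. dominant_rational_map {..<p} I X \<phi> \<and>
        trop_map v {..<p} I \<phi> ` ({..<p} \<rightarrow>\<^sub>E UNIV) = trop_variety v I X)"


subsection \<open>Singular matrices\<close>

text \<open>Empty for \<open>n \<le> 1\<close> (the determinant is \<open>1\<close> or the single non-zero entry), hence not the
  target of any rational map from a torus in these cases.\<close>

definition singular_matrices :: "nat \<Rightarrow> (nat \<times> nat \<Rightarrow> 'k::field) set" where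
  "singular_matrices n = {M \<in> torus ({..<n} \<times> {..<n}). det (mat n n M) = 0}"


subsection \<open>Independence of the chosen fraction\<close>

lemma poly_mapping_eq_sum_single:
  fixes f :: "'a \<Rightarrow>\<^sub>0 'b::comm_monoid_add"
  shows "f = (\<Sum>a\<in>Poly_Mapping.keys f. Poly_Mapping.single a (Poly_Mapping.lookup f a))"
proof (rule poly_mapping_eqI)
  fix k
  have "(\<Sum>a\<in>Poly_Mapping.keys f. (Poly_Mapping.lookup f a when a = k)) = Poly_Mapping.lookup f k"
    by (auto simp: when_def in_keys_iff)
  then show "Poly_Mapping.lookup f k = Poly_Mapping.lookup
      (\<Sum>a\<in>Poly_Mapping.keys f. Poly_Mapping.single a (Poly_Mapping.lookup f a)) k"
    by (simp add: lookup_sum lookup_single)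
qed

lemma times_eq_sum_single:
  fixes f g :: "'a::monoid_add \<Rightarrow>\<^sub>0 'b::semiring_0"
  shows "f * g = (\<Sum>a\<in>Poly_Mapping.keys f. \<Sum>b\<in>Poly_Mapping.keys g.
     Poly_Mapping.single (a + b) (Poly_Mapping.lookup f a * Poly_Mapping.lookup g b))"
proof -
  have "f * g =
      (\<Sum>a\<in>Poly_Mapping.keys f. Poly_Mapping.single a (Poly_Mapping.lookup f a)) *
      (\<Sum>b\<in>Poly_Mapping.keys g. Poly_Mapping.single b (Poly_Mapping.lookup g b))"
    using poly_mapping_eq_sum_single[of f] poly_mapping_eq_sum_single[of g] by argo
  then show ?thesis by (simp add: sum_product mult_single)
qed

lemma monom_eval_superset:
  assumes "finite S" "Poly_Mapping.keys \<alpha> \<subseteq> S"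
  shows "monom_eval \<alpha> x = (\<Prod>i\<in>S. x i powi Poly_Mapping.lookup \<alpha> i)"
  unfolding monom_eval_def
  by (rule prod.mono_neutral_left) (use assms in \<open>auto simp: in_keys_iff\<close>)

lemma monom_eval_add:
  assumes "x \<in> torus I" "Poly_Mapping.keys \<alpha> \<subseteq> I" "Poly_Mapping.keys \<beta> \<subseteq> I"
  shows "monom_eval (\<alpha> + \<beta>) x = monom_eval \<alpha> x * monom_eval \<beta> x"
proof -
  let ?S = "Poly_Mapping.keys \<alpha> \<union> Poly_Mapping.keys \<beta>"
  have S: "finite ?S" "Poly_Mapping.keys (\<alpha> + \<beta>) \<subseteq> ?S"
    using Poly_Mapping.keys_add[of \<alpha> \<beta>] by auto
  have nz: "x i \<noteq> 0" if "i \<in> ?S" for i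
    using that assms by (auto simp: torus_def PiE_def Pi_def)
  show ?thesis
    using S nz by (simp add: monom_eval_superset[of ?S] lookup_add power_int_add prod.distrib)
qed

lemma laurent_eval_superset:
  assumes "finite S" "Poly_Mapping.keys f \<subseteq> S"
  shows "laurent_eval f x = (\<Sum>a\<in>S. Poly_Mapping.lookup f a * monom_eval a x)"
  unfolding laurent_eval_def
  by (rule sum.mono_neutral_left) (use assms in \<open>auto simp: in_keys_iff\<close>)

lemma laurent_eval_zero [simp]: "laurent_eval 0 x = 0"
  by (simp add: laurent_eval_def)

lemma laurent_eval_add: "laurent_eval (f + g) x = laurent_eval f x + laurent_eval g x"
proof -
  let ?S = "Poly_Mapping.keys f \<union> Poly_Mapping.keys g"
  have S: "finite ?S" "Poly_Mapping.keys (f + g) \<subseteq> ?S"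
    using Poly_Mapping.keys_add[of f g] by auto
  show ?thesis
    using S by (simp add: laurent_eval_superset[of ?S] lookup_add algebra_simps sum.distrib)
qed

lemma laurent_eval_sum: "laurent_eval (sum F A) x = (\<Sum>a\<in>A. laurent_eval (F a) x)"
  by (induction A rule: infinite_finite_induct) (auto simp: laurent_eval_add)

lemma laurent_eval_single: "laurent_eval (Poly_Mapping.single a c) x = c * monom_eval a x"
  by (cases "c = 0") (auto simp: laurent_eval_def)

lemma laurent_eval_mult:
  assumes "x \<in> torus I" "f \<in> laurent_polys I" "g \<in> laurent_polys I"
  shows "laurent_eval (f * g) x = laurent_eval f x * laurent_eval g x"
proof -
  have "laurent_eval (f * g) x = (\<Sum>a\<in>Poly_Mapping.keys f. \<Sum>b\<in>Poly_Mapping.keys g.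
     Poly_Mapping.lookup f a * Poly_Mapping.lookup g b * monom_eval (a + b) x)"
    by (subst times_eq_sum_single) (simp add: laurent_eval_sum laurent_eval_single)
  also have "\<dots> = (\<Sum>a\<in>Poly_Mapping.keys f. \<Sum>b\<in>Poly_Mapping.keys g.
     (Poly_Mapping.lookup f a * monom_eval a x) * (Poly_Mapping.lookup g b * monom_eval b x))"
    using assms
    by (intro sum.cong refl) (auto simp: laurent_polys_def monom_eval_add[of x I])
  also have "\<dots> = laurent_eval f x * laurent_eval g x"
    by (simp add: laurent_eval_def sum_product)
  finally show ?thesis .
qed

lemma ratfun_eval_eq:
  assumes x: "x \<in> torus J" and r: "is_fraction J r f h" and h: "laurent_eval h x \<noteq> 0"
  shows "ratfun_eval J r x = laurent_eval f x / laurent_eval h x"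
  unfolding ratfun_eval_def
proof (rule the_equality)
  fix c
  assume "\<exists>f' h'. is_fraction J r f' h' \<and> laurent_eval h' x \<noteq> 0 \<and>
    c = laurent_eval f' x / laurent_eval h' x"
  then obtain f' h' where r': "is_fraction J r f' h'" and h': "laurent_eval h' x \<noteq> 0"
    and c: "c = laurent_eval f' x / laurent_eval h' x" by blast
  have "Fract f h = Fract f' h'" "h \<noteq> 0" "h' \<noteq> 0"
    using r r' by (auto simp: is_fraction_def)
  then have "f * h' = f' * h" by (simp add: eq_fract)
  then have "laurent_eval f x * laurent_eval h' x = laurent_eval f' x * laurent_eval h x"
    using r r' laurent_eval_mult[OF x] unfolding is_fraction_def by metis
  then show "c = laurent_eval f x / laurent_eval h x"
    unfolding c using h h' by (simp add: frac_eq_eq)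
qed (use assms in blast)

lemma exponent_pairing_superset:
  assumes "finite S" "Poly_Mapping.keys \<alpha> \<subseteq> S"
  shows "exponent_pairing \<xi> \<alpha> = (\<Sum>i\<in>S. \<xi> i * of_int (Poly_Mapping.lookup \<alpha> i))"
  unfolding exponent_pairing_def
  by (rule sum.mono_neutral_left) (use assms in \<open>auto simp: in_keys_iff\<close>)

lemma exponent_pairing_add:
  "exponent_pairing \<xi> (\<alpha> + \<beta>) = exponent_pairing \<xi> \<alpha> + exponent_pairing \<xi> \<beta>"
proof -
  let ?S = "Poly_Mapping.keys \<alpha> \<union> Poly_Mapping.keys \<beta>"
  have S: "finite ?S" "Poly_Mapping.keys (\<alpha> + \<beta>) \<subseteq> ?S"
    using Poly_Mapping.keys_add[of \<alpha> \<beta>] by auto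
  show ?thesis
    using S by (simp add: exponent_pairing_superset[of ?S] lookup_add algebra_simps sum.distrib)
qed

context
  fixes v :: "'k::field \<Rightarrow> ereal"
  assumes v: "nonarch_valuation v"
begin

lemma val_zero: "v 0 = \<infinity>"
  and val_mult: "v (x * y) = v x + v y"
  and val_add: "min (v x) (v y) \<le> v (x + y)"
  using v by (auto simp: nonarch_valuation_def)

lemma val_finite: "x \<noteq> 0 \<Longrightarrow> \<exists>r. v x = ereal r"
  using v by (cases "v x") (auto simp: nonarch_valuation_def)

lemma val_minus: "v (- x) = v x"
proof -
  obtain a where a: "v 1 = ereal a" using val_finite[of 1] by auto
  obtain b where b: "v (- 1) = ereal b" using val_finite[of "- 1"] by auto
  have "a = 0" using val_mult[of 1 1] a by simp
  moreover have "b + b = a" using val_mult[of "- 1" "- 1"] a b by simp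
  ultimately have "v (- 1) = 0" using b by simp
  then show ?thesis using val_mult[of "- 1" x] by simp
qed

lemma val_sum_ge:
  assumes "\<And>a. a \<in> A \<Longrightarrow> c \<le> v (F a)"
  shows "c \<le> v (sum F A)"
  using assms
proof (induction A rule: infinite_finite_induct)
  case (insert a A)
  then have "c \<le> min (v (F a)) (v (sum F A))" by auto
  also note val_add
  finally show ?case using insert.hyps by simp
qed (auto simp: val_zero)

lemma val_sum_gr:
  assumes "\<And>a. a \<in> A \<Longrightarrow> c < v (F a)" "c < \<infinity>"
  shows "c < v (sum F A)"
  using assms
proof (induction A rule: infinite_finite_induct)
  case (insert a A)
  then have "c < min (v (F a)) (v (sum F A))" by auto
  also note val_add
  finally show ?case using insert.hyps by simp
qed (auto simp: val_zero)

lemma val_add_dominant: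
  assumes "v x < v y"
  shows "v (x + y) = v x"
proof (rule antisym)
  have "min (v (x + y)) (v (- y)) \<le> v ((x + y) + (- y))" by (rule val_add)
  then show "v (x + y) \<le> v x" using assms by (auto simp: val_minus min_def split: if_splits)
  show "v x \<le> v (x + y)" using val_add[of x y] assms by (simp add: min_absorb1 less_imp_le)
qed

lemma trop_poly_mult:
  fixes f g :: "('j::linorder, 'k) laurent"
  assumes f: "f \<noteq> 0" and g: "g \<noteq> 0"
  shows "trop_poly v (f * g) \<xi> = trop_poly v f \<xi> + trop_poly v g \<xi>"
proof -
  let ?l = "Poly_Mapping.lookup" and ?K = "Poly_Mapping.keys" and ?w = "exponent_pairing \<xi>"
  let ?rv = "\<lambda>x. real_of_ereal (v x)"
  have nzK: "?K f \<noteq> {}" "?K g \<noteq> {}" using f g by auto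
  have rv: "v x = ereal (?rv x)" if "x \<noteq> 0" for x
    using val_finite[OF that] by auto
  have rvm: "?rv (x * y) = ?rv x + ?rv y" if "x \<noteq> 0" "y \<noteq> 0" for x y
    using val_mult[of x y] rv[OF that(1)] rv[OF that(2)] by (metis plus_ereal.simps(1) real_of_ereal.simps(1))
  define P where "P \<gamma> = {ab \<in> ?K f \<times> ?K g. fst ab + snd ab = \<gamma>}" for \<gamma>
  let ?t = "\<lambda>ab. ?l f (fst ab) * ?l g (snd ab)"
  have finP: "finite (P \<gamma>)" for \<gamma> unfolding P_def by simp
  have coeff: "?l (f * g) \<gamma> = (\<Sum>ab\<in>P \<gamma>. ?t ab)" for \<gamma>
  proof -
    have "?l (f * g) \<gamma> = (\<Sum>ab\<in>?K f \<times> ?K g. if fst ab + snd ab = \<gamma> then ?t ab else 0)"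
      by (subst times_eq_sum_single)
         (simp add: lookup_sum lookup_single when_def sum.cartesian_product case_prod_unfold)
    also have "\<dots> = (\<Sum>ab\<in>P \<gamma>. ?t ab)"
      unfolding P_def by (rule sum.inter_filter[symmetric]) simp
    finally show ?thesis .
  qed
  have wf: "trop_poly v f \<xi> \<le> term_weight v f \<xi> a" if "a \<in> ?K f" for a
    using that by (simp add: trop_poly_def)
  have wg: "trop_poly v g \<xi> \<le> term_weight v g \<xi> b" if "b \<in> ?K g" for b
    using that by (simp add: trop_poly_def)
  have vt: "v (?t ab) = ereal (term_weight v f \<xi> (fst ab) + term_weight v g \<xi> (snd ab) - ?w \<gamma>)"
    if "ab \<in> P \<gamma>" for ab \<gamma>
  proof -
    have nz: "?l f (fst ab) \<noteq> 0" "?l g (snd ab) \<noteq> 0" and s: "\<gamma> = fst ab + snd ab"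
      using that by (auto simp: P_def in_keys_iff)
    have "v (?t ab) = ereal (?rv (?t ab))" using nz by (intro rv) auto
    then show ?thesis using rvm[OF nz] by (simp add: term_weight_def exponent_pairing_add s)
  qed
  have lower: "trop_poly v f \<xi> + trop_poly v g \<xi> \<le> term_weight v (f * g) \<xi> \<gamma>"
    if "\<gamma> \<in> ?K (f * g)" for \<gamma>
  proof -
    have "ereal (trop_poly v f \<xi> + trop_poly v g \<xi> - ?w \<gamma>) \<le> v (\<Sum>ab\<in>P \<gamma>. ?t ab)"
    proof (rule val_sum_ge)
      fix ab assume ab: "ab \<in> P \<gamma>"
      then have "fst ab \<in> ?K f" "snd ab \<in> ?K g" by (auto simp: P_def)
      then show "ereal (trop_poly v f \<xi> + trop_poly v g \<xi> - ?w \<gamma>) \<le> v (?t ab)"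
        unfolding vt[OF ab] using wf[of "fst ab"] wg[of "snd ab"] by simp
    qed
    moreover have "v (?l (f * g) \<gamma>) = ereal (?rv (?l (f * g) \<gamma>))"
      using that by (intro rv) (simp add: in_keys_iff)
    ultimately have "trop_poly v f \<xi> + trop_poly v g \<xi> - ?w \<gamma> \<le> ?rv (?l (f * g) \<gamma>)"
      unfolding coeff[symmetric] by (metis ereal_less_eq(3))
    then show ?thesis by (simp add: term_weight_def)
  qed
  define A where "A = {a \<in> ?K f. term_weight v f \<xi> a = trop_poly v f \<xi>}"
  define B where "B = {b \<in> ?K g. term_weight v g \<xi> b = trop_poly v g \<xi>}"
  have "trop_poly v f \<xi> \<in> term_weight v f \<xi> ` ?K f"
    unfolding trop_poly_def using nzK by (intro Min_in) auto
  then have A: "finite A" "A \<noteq> {}" by (auto simp: A_def)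
  have "trop_poly v g \<xi> \<in> term_weight v g \<xi> ` ?K g"
    unfolding trop_poly_def using nzK by (intro Min_in) auto
  then have B: "finite B" "B \<noteq> {}" by (auto simp: B_def)
  define a0 where "a0 = Max A"
  define b0 where "b0 = Max B"
  have a0: "a0 \<in> A" and b0: "b0 \<in> B" unfolding a0_def b0_def using A B by auto
  define \<gamma> where "\<gamma> = a0 + b0"
  have ab0: "(a0, b0) \<in> P \<gamma>" using a0 b0 by (auto simp: P_def A_def B_def \<gamma>_def)
  define c where "c = trop_poly v f \<xi> + trop_poly v g \<xi> - ?w \<gamma>"
  have v0: "v (?t (a0, b0)) = ereal c"
    using vt[OF ab0] a0 b0 by (simp add: A_def B_def c_def)
  have rest: "ereal c < v (\<Sum>ab\<in>P \<gamma> - {(a0, b0)}. ?t ab)"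
  proof (rule val_sum_gr)
    fix ab assume "ab \<in> P \<gamma> - {(a0, b0)}"
    then have ab: "ab \<in> P \<gamma>" and ne: "ab \<noteq> (a0, b0)" by auto
    obtain a b where [simp]: "ab = (a, b)" by force
    have K: "a \<in> ?K f" "b \<in> ?K g" and s: "a + b = a0 + b0"
      using ab by (auto simp: P_def \<gamma>_def)
    have "\<not> (a \<in> A \<and> b \<in> B)"
    proof
      assume "a \<in> A \<and> b \<in> B"
      then have le: "a \<le> a0" "b \<le> b0" using A B by (auto simp: a0_def b0_def)
      have "a = a0"
      proof (rule ccontr)
        assume "a \<noteq> a0"
        then have "a < a0" using le by simp
        then have "a + b < a0 + b0" using le(2) by (rule add_less_le_mono)
        then show False using s by simp
      qed
      then show False using s ne by simp
    qed
    then have "trop_poly v f \<xi> + trop_poly v g \<xi> < term_weight v f \<xi> a + term_weight v g \<xi> b"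
      using K wf[OF K(1)] wg[OF K(2)] by (auto simp: A_def B_def)
    then show "ereal c < v (?t ab)" unfolding vt[OF ab] by (simp add: c_def)
  qed simp
  have "?l (f * g) \<gamma> = ?t (a0, b0) + (\<Sum>ab\<in>P \<gamma> - {(a0, b0)}. ?t ab)"
    unfolding coeff by (rule sum.remove[OF finP ab0])
  then have vc: "v (?l (f * g) \<gamma>) = ereal c"
    using val_add_dominant[of "?t (a0, b0)" "\<Sum>ab\<in>P \<gamma> - {(a0, b0)}. ?t ab"] rest
    unfolding v0 by simp
  then have "?l (f * g) \<gamma> \<noteq> 0" using val_zero by auto
  then have "\<gamma> \<in> ?K (f * g)" by (simp add: in_keys_iff)
  moreover have "term_weight v (f * g) \<xi> \<gamma> = trop_poly v f \<xi> + trop_poly v g \<xi>"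
    using vc by (simp add: term_weight_def c_def)
  ultimately show ?thesis
    unfolding trop_poly_def[of v "f * g"] using lower
    by (intro Min_eqI) (auto intro: image_eqI[of _ _ \<gamma>])
qed

lemma trop_ratfun_eq:
  assumes r: "is_fraction J r f h" and f: "f \<noteq> 0"
  shows "trop_ratfun v J r \<xi> = trop_poly v f \<xi> - trop_poly v h \<xi>"
  unfolding trop_ratfun_def
proof (rule the_equality)
  fix c
  assume "\<exists>f' h'. is_fraction J r f' h' \<and> f' \<noteq> 0 \<and> c = trop_poly v f' \<xi> - trop_poly v h' \<xi>"
  then obtain f' h' where r': "is_fraction J r f' h'" and f': "f' \<noteq> 0"
    and c: "c = trop_poly v f' \<xi> - trop_poly v h' \<xi>" by blast
  have eq: "Fract f h = Fract f' h'" and h: "h \<noteq> 0" "h' \<noteq> 0"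
    using r r' by (auto simp: is_fraction_def)
  then have "f * h' = f' * h" by (simp add: eq_fract)
  then have "trop_poly v f \<xi> + trop_poly v h' \<xi> = trop_poly v f' \<xi> + trop_poly v h \<xi>"
    using trop_poly_mult f f' h by metis
  then show "c = trop_poly v f \<xi> - trop_poly v h \<xi>" using c by simp
qed (use assms in blast)

end

end

theory Submission
  imports Defs
begin

text \<open>For a matrix \<open>A\<close> and vectors \<open>u\<close>, \<open>w\<close> put \<open>d = w\<^sup>T (adj A) u\<close>. The matrix
  \<open>A - (det A / d) u w\<^sup>T\<close> annihilates \<open>adj A u\<close>, hence is singular, and it equals \<open>A\<close> if \<open>A\<close> is
  already singular. So this rational map reaches every singular matrix of corank one, and these
  are dense among the singular matrices.

  Let the tropical determinant at \<open>\<xi>\<close> be attained at two permutations, one using the entry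
  \<open>(i, j)\<close> and one not. Giving all \<open>u\<^sub>k\<close>, \<open>w\<^sub>l\<close> except \<open>u\<^sub>i\<close>, \<open>w\<^sub>j\<close> large valuation turns the
  map into solving \<open>det = 0\<close> for the entry \<open>(i, j)\<close>, and this tropicalizes to a map fixing \<open>\<xi>\<close>.
  Conversely, tropicalization at a fixed point is a valuation on the Laurent polynomial ring, so
  an identity \<open>f(\<phi>) = 0\<close> forces the minimum in \<open>Trop(f)\<close> to be attained twice.\<close>

subsection \<open>Laurent polynomials over an infinite field\<close>

text \<open>\<open>Trop(X)\<close> is an intersection over a whole ideal; it gets trapped between
  two sets: it lies in the corner locus of the determinant, each point of that locus is a value of
  the tropicalized parametrization, and each such value lies in \<open>Trop(X)\<close>. The obstacle
  is cancellation, since the valuation of a difference is controlled only if one term is strictly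
  smaller. The numerator at (k, l) is \<open>a_kl d - u_k w_l det A\<close>. Away from (i, j) the
  large valuations make the first term win. At (i, j) the terms tie, but the Leibniz terms through
  \<open>a_ij\<close> cancel identically, and \<open>- u_i w_j\<close> times the part of
  \<open>det A\<close> avoiding (i, j) leads what remains. With \<open>m\<close> the tropical
  determinant, the permutation avoiding (i, j) gives this the valuation \<open>m\<close>, and the
  one using (i, j) gives \<open>d\<close> the valuation \<open>m - \<xi>_ij\<close>; the quotient
  has \<open>\<xi>_ij\<close>. So both halves of the tie enter. A second obstacle: a rational
  function can be regular where a chosen fraction for it is not. Equations are therefore turned into
  identities of Laurent polynomials before they are evaluated or tropicalized.\<close>

lemma infinite_UNIV_alg_closed: "infinite (UNIV :: 'k::alg_closed_field set)"
proof
  assume fin: "finite (UNIV :: 'k set)"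
  define q where "q = (\<Prod>a\<in>(UNIV :: 'k set). [:- a, 1:])"
  have "poly q x = 0" for x
    using fin by (auto simp: q_def poly_prod)
  \<comment> \<open>\<open>q\<close> vanishes at every element of the field, so \<open>q + 1\<close>
    takes only the value 1, although its degree is positive.\<close>
  then have no_root: "poly (q + 1) x \<noteq> 0" for x by simp
  have "degree q = (\<Sum>a\<in>(UNIV :: 'k set). 1)"
    unfolding q_def by (subst degree_prod_eq_sum_degree) auto
  then have "degree q > 0" using fin by (simp add: card_gt_0_iff)
  then have "degree (q + 1) > 0"
    by (simp add: degree_add_eq_left)
  then show False using alg_closed_imp_poly_has_root no_root by blast
qed

lemma exists_powi_neq:
  fixes a b :: int
  assumes inf: "infinite (UNIV :: 'k::field set)" and ab: "a \<noteq> b"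
  shows "\<exists>t::'k. t \<noteq> 0 \<and> t powi a \<noteq> t powi b"
proof -
  have *: "\<exists>t::'k. t \<noteq> 0 \<and> t powi a \<noteq> t powi b" if "a < b" for a b :: int
  proof -
    let ?p = "monom (1::'k) (nat (b - a)) - 1"
    have "coeff ?p (nat (b - a)) = 1" using that by (simp add: coeff_monom)
    then have "?p \<noteq> 0" by force
    from poly_roots_finite[OF this] have "finite (insert 0 {t. poly ?p t = 0})" by simp
    then obtain t where t: "t \<notin> insert 0 {t. poly ?p t = 0}"
      using inf ex_new_if_finite by blast
    have "t powi b = t powi a * t ^ nat (b - a)"
      using t that power_int_add[of t a "b - a"] by (simp add: power_int_def)
    moreover have "t ^ nat (b - a) \<noteq> 1" using t by (simp add: poly_monom)
    ultimately show ?thesis using t by (intro exI[of _ t]) auto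
  qed
  show ?thesis using *[of a b] *[of b a] ab by (metis linorder_neqE)
qed

lemma monom_eval_zero [simp]: "monom_eval 0 x = 1"
  by (simp add: monom_eval_def)

lemma monom_eval_one: "Poly_Mapping.keys \<alpha> \<subseteq> J \<Longrightarrow> monom_eval \<alpha> (\<lambda>i\<in>J. 1) = 1"
  unfolding monom_eval_def by (rule prod.neutral) auto

lemma monom_eval_mult:
  assumes "Poly_Mapping.keys \<alpha> \<subseteq> J"
  shows "monom_eval \<alpha> (\<lambda>i\<in>J. x i * y i) = monom_eval \<alpha> x * monom_eval \<alpha> y"
  unfolding monom_eval_def prod.distrib[symmetric]
  by (rule prod.cong) (use assms in \<open>auto simp: power_int_mult_distrib\<close>)

text \<open>The exponents differ in some coordinate \<open>i\<close>; moving only that coordinate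
  away from 1 reduces the claim to two powers of one scalar.\<close>

lemma monom_separating_point:
  assumes "infinite (UNIV :: 'k::field set)" "Poly_Mapping.keys \<alpha> \<subseteq> J"
    "Poly_Mapping.keys \<beta> \<subseteq> J" "\<alpha> \<noteq> \<beta>"
  shows "\<exists>y \<in> torus J. monom_eval \<alpha> y \<noteq> (monom_eval \<beta> y :: 'k)"
proof -
  obtain i where i: "Poly_Mapping.lookup \<alpha> i \<noteq> Poly_Mapping.lookup \<beta> i"
    using assms(4) by (metis poly_mapping_eqI)
  then have iJ: "i \<in> J" using assms(2,3) by (metis in_keys_iff subsetD)
  obtain t :: 'k where t: "t \<noteq> 0"
    "t powi Poly_Mapping.lookup \<alpha> i \<noteq> t powi Poly_Mapping.lookup \<beta> i"
    using exists_powi_neq[OF assms(1) i] by blast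
  define y where "y = (\<lambda>k\<in>J. if k = i then t else 1)"
  have "monom_eval \<gamma> y = t powi Poly_Mapping.lookup \<gamma> i" if "Poly_Mapping.keys \<gamma> \<subseteq> J" for \<gamma>
  proof -
    have "monom_eval \<gamma> y = (\<Prod>k\<in>insert i (Poly_Mapping.keys \<gamma>). y k powi Poly_Mapping.lookup \<gamma> k)"
      by (rule monom_eval_superset) auto
    also have "\<dots> = (\<Prod>k\<in>{i}. y k powi Poly_Mapping.lookup \<gamma> k)"
      by (rule prod.mono_neutral_right) (use that in \<open>auto simp: y_def\<close>)
    finally show ?thesis using iJ by (simp add: y_def)
  qed
  moreover have "y \<in> torus J" using t by (auto simp: y_def torus_def)
  ultimately show ?thesis using t assms by metis
qed

text \<open>Monomials are characters of the torus, and this is Dedekind's independence argument: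
  translate the relation by a point \<open>y\<close> and subtract a multiple of the original
  relation to remove one character.\<close>

lemma monomials_independent:
  fixes c :: "('i \<Rightarrow>\<^sub>0 int) \<Rightarrow> 'k::field"
  assumes inf: "infinite (UNIV :: 'k set)" and "finite S"
    and "\<And>\<alpha>. \<alpha> \<in> S \<Longrightarrow> Poly_Mapping.keys \<alpha> \<subseteq> J"
    and "\<And>x. x \<in> torus J \<Longrightarrow> (\<Sum>\<alpha>\<in>S. c \<alpha> * monom_eval \<alpha> x) = 0"
    and "\<alpha> \<in> S"
  shows "c \<alpha> = 0"
  using assms(2-)
proof (induction S arbitrary: c \<alpha>)
  case (insert \<beta> S)
  have zero: "c \<gamma> = 0" if \<gamma>: "\<gamma> \<in> S" for \<gamma>
  proof -
    obtain y where y: "y \<in> torus J" "monom_eval \<gamma> y \<noteq> (monom_eval \<beta> y :: 'k)"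
      using monom_separating_point[OF inf, of \<gamma> J \<beta>] insert.prems(1) insert.hyps \<gamma>
      by (metis insert_iff)
    have "c \<gamma> * (monom_eval \<gamma> y - monom_eval \<beta> y) = 0"
    proof (rule insert.IH[of "\<lambda>\<gamma>. c \<gamma> * (monom_eval \<gamma> y - monom_eval \<beta> y)"])
      fix x :: "'i \<Rightarrow> 'k" assume x: "x \<in> torus J"
      have xy: "(\<lambda>i\<in>J. x i * y i) \<in> torus J" using x y by (auto simp: torus_def PiE_def Pi_def)
      \<comment> \<open>Each coefficient is multiplied by
        \<open>monom_eval \<alpha> y - monom_eval \<beta> y\<close>, which is zero for
        \<open>\<beta>\<close> and non-zero for the chosen \<open>\<gamma>\<close>.\<close>
      have "0 = (\<Sum>\<alpha>\<in>insert \<beta> S. c \<alpha> * monom_eval \<alpha> (\<lambda>i\<in>J. x i * y i))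
        - monom_eval \<beta> y * (\<Sum>\<alpha>\<in>insert \<beta> S. c \<alpha> * monom_eval \<alpha> x)"
        by (simp only: insert.prems(2)[OF xy] insert.prems(2)[OF x] mult_zero_right diff_self)
      also have "\<dots> = (\<Sum>\<alpha>\<in>insert \<beta> S. c \<alpha> * (monom_eval \<alpha> y - monom_eval \<beta> y) * monom_eval \<alpha> x)"
        unfolding sum_distrib_left sum_subtractf[symmetric]
        by (rule sum.cong) (use insert.prems(1) in \<open>auto simp: monom_eval_mult algebra_simps\<close>)
      also have "\<dots> = (\<Sum>\<alpha>\<in>S. c \<alpha> * (monom_eval \<alpha> y - monom_eval \<beta> y) * monom_eval \<alpha> x)"
        using insert.hyps by simp
      finally show "(\<Sum>\<alpha>\<in>S. c \<alpha> * (monom_eval \<alpha> y - monom_eval \<beta> y) * monom_eval \<alpha> x) = 0"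
        by simp
    qed (use insert.prems \<gamma> in auto)
    then show ?thesis using y by simp
  qed
  \<comment> \<open>Only the term of \<open>\<beta>\<close> is left; at the point with all
    coordinates 1 its monomial equals 1.\<close>
  have "(\<lambda>i\<in>J. 1 :: 'k) \<in> torus J" by (auto simp: torus_def)
  from insert.prems(2)[OF this] have "c \<beta> * monom_eval \<beta> (\<lambda>i\<in>J. 1) = 0"
    using insert.hyps zero by (simp del: restrict_apply)
  then have "c \<beta> = 0"
    using monom_eval_one[of \<beta> J] insert.prems(1) by (metis insertI1 mult.right_neutral)
  then show ?case using zero insert.prems(3) by auto
qed simp

text \<open>The bridge from statements about points of the torus to identities in the Laurent
  polynomial ring, on which tropicalization acts.\<close>

lemma laurent_eval_eq_zeroD:
  fixes f :: "('i, 'k::field) laurent"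
  assumes "infinite (UNIV :: 'k set)" "f \<in> laurent_polys J"
    and "\<And>x. x \<in> torus J \<Longrightarrow> laurent_eval f x = 0"
  shows "f = 0"
proof (rule poly_mapping_eqI)
  fix \<alpha>
  show "Poly_Mapping.lookup f \<alpha> = Poly_Mapping.lookup 0 \<alpha>"
  proof (cases "\<alpha> \<in> Poly_Mapping.keys f")
    case True
    have "Poly_Mapping.lookup f \<alpha> = 0"
      by (rule monomials_independent[OF assms(1) finite_keys _ _ True, of J])
         (use assms in \<open>auto simp: laurent_polys_def laurent_eval_def\<close>)
    then show ?thesis by simp
  qed (simp add: in_keys_iff)
qed

lemma single_eq_0_iff: "Poly_Mapping.single \<alpha> c = 0 \<longleftrightarrow> c = 0"
  by (metis lookup_single_eq lookup_zero single_zero)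

lemma laurent_polys_zero [simp]: "0 \<in> laurent_polys J"
  by (simp add: laurent_polys_def)

lemma laurent_polys_add:
  "f \<in> laurent_polys J \<Longrightarrow> g \<in> laurent_polys J \<Longrightarrow> f + g \<in> laurent_polys J"
  using Poly_Mapping.keys_add[of f g] by (auto simp: laurent_polys_def)

lemma laurent_polys_uminus:
  fixes f :: "('j, 'k::ab_group_add) laurent"
  shows "f \<in> laurent_polys J \<Longrightarrow> - f \<in> laurent_polys J"
  by (auto simp: laurent_polys_def in_keys_iff)

lemma laurent_polys_diff:
  fixes f :: "('j, 'k::ab_group_add) laurent"
  shows "f \<in> laurent_polys J \<Longrightarrow> g \<in> laurent_polys J \<Longrightarrow> f - g \<in> laurent_polys J"
  using laurent_polys_add[OF _ laurent_polys_uminus] by fastforce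

lemma laurent_polys_sum:
  "(\<And>a. a \<in> A \<Longrightarrow> F a \<in> laurent_polys J) \<Longrightarrow> sum F A \<in> laurent_polys J"
  by (induction A rule: infinite_finite_induct) (auto simp: laurent_polys_add)

lemma laurent_polys_single:
  "Poly_Mapping.keys \<alpha> \<subseteq> J \<Longrightarrow> Poly_Mapping.single \<alpha> c \<in> laurent_polys J"
  by (auto simp: laurent_polys_def)

lemma laurent_polys_mult:
  assumes "f \<in> laurent_polys J" "g \<in> laurent_polys J"
  shows "f * g \<in> laurent_polys J"
  unfolding laurent_polys_def
proof (clarify, rule ccontr)
  fix \<gamma> i assume \<gamma>: "\<gamma> \<in> Poly_Mapping.keys (f * g)" "i \<in> Poly_Mapping.keys \<gamma>" "i \<notin> J"
  then obtain \<alpha> \<beta> where "\<gamma> = \<alpha> + \<beta>" "\<alpha> \<in> Poly_Mapping.keys f" "\<beta> \<in> Poly_Mapping.keys g"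
    using Poly_Mapping.keys_mult[of f g] by blast
  then show False
    using assms \<gamma> Poly_Mapping.keys_add[of \<alpha> \<beta>] unfolding laurent_polys_def by blast
qed

lemma laurent_polys_one: "1 \<in> laurent_polys J"
  by (simp add: laurent_polys_def)

lemma laurent_polys_power: "f \<in> laurent_polys J \<Longrightarrow> f ^ m \<in> laurent_polys J"
  for f :: "('j, 'k::comm_ring_1) laurent"
  by (induction m) (auto simp: laurent_polys_one laurent_polys_mult)

lemma laurent_polys_prod:
  fixes F :: "'a \<Rightarrow> ('j, 'k::comm_ring_1) laurent"
  shows "(\<And>a. a \<in> A \<Longrightarrow> F a \<in> laurent_polys J) \<Longrightarrow> prod F A \<in> laurent_polys J"
  by (induction A rule: infinite_finite_induct) (auto simp: laurent_polys_one laurent_polys_mult)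

lemma laurent_eval_uminus: "laurent_eval (- f) x = - laurent_eval f x"
  using laurent_eval_add[of f "- f" x] by (simp add: eq_neg_iff_add_eq_0 add.commute)

lemma laurent_eval_diff: "laurent_eval (f - g) x = laurent_eval f x - laurent_eval g x"
  using laurent_eval_add[of f "- g" x] by (simp add: laurent_eval_uminus)

lemma laurent_eval_one [simp]: "laurent_eval 1 x = 1"
  by (simp add: laurent_eval_def lookup_one)

lemma laurent_eval_power:
  assumes "x \<in> torus J" "f \<in> laurent_polys J"
  shows "laurent_eval (f ^ m) x = laurent_eval f x ^ m"
  by (induction m) (auto simp: laurent_eval_mult[OF assms(1)] assms laurent_polys_power)

lemma laurent_eval_prod:
  assumes "x \<in> torus J" "\<And>a. a \<in> A \<Longrightarrow> F a \<in> laurent_polys J"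
  shows "laurent_eval (prod F A) x = (\<Prod>a\<in>A. laurent_eval (F a) x)"
  using assms(2)
  by (induction A rule: infinite_finite_induct)
     (auto simp: laurent_eval_mult[OF assms(1)] laurent_polys_prod)

subsection \<open>Clearing denominators\<close>

lemma ex_exponent_bound:
  fixes f :: "('i, 'k::zero) laurent"
  assumes "finite I"
  shows "\<exists>k::nat. \<forall>\<alpha>\<in>Poly_Mapping.keys f. \<forall>i\<in>I. \<bar>Poly_Mapping.lookup \<alpha> i\<bar> < int k"
proof -
  let ?A = "(\<lambda>(\<alpha>, i). nat \<bar>Poly_Mapping.lookup \<alpha> i\<bar>) ` (Poly_Mapping.keys f \<times> I)"
  have fin: "finite ?A" using assms by simp
  have "\<bar>Poly_Mapping.lookup \<alpha> i\<bar> < int (Suc (Max (insert 0 ?A)))"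
    if "\<alpha> \<in> Poly_Mapping.keys f" "i \<in> I" for \<alpha> i
  proof -
    have "nat \<bar>Poly_Mapping.lookup \<alpha> i\<bar> \<le> Max (insert 0 ?A)"
      using that by (intro Max_ge) (use fin in force)+
    then show ?thesis by linarith
  qed
  then show ?thesis by blast
qed

text \<open>In each coordinate \<open>y^(k+a) h^(k-a) = (y/h)^a (y h)^k\<close>, and the last factor
  does not depend on \<open>a\<close>. The bound \<open>k\<close> keeps both exponents non-negative,
  so \<open>nat\<close> truncates nothing. The factor \<open>y^k\<close> is needed because a Laurent
  exponent \<open>a\<close> may be negative.\<close>

lemma clear_denominators_field:
  fixes y h :: "'i \<Rightarrow> 'k::field"
  assumes f: "f \<in> laurent_polys I" and I: "finite I"
    and k: "\<forall>\<alpha>\<in>Poly_Mapping.keys f. \<forall>i\<in>I. \<bar>Poly_Mapping.lookup \<alpha> i\<bar> < int k"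
    and nz: "\<And>i. i \<in> I \<Longrightarrow> y i \<noteq> 0" "\<And>i. i \<in> I \<Longrightarrow> h i \<noteq> 0"
  shows "(\<Sum>\<alpha>\<in>Poly_Mapping.keys f. Poly_Mapping.lookup f \<alpha> *
      (\<Prod>i\<in>I. y i ^ nat (int k + Poly_Mapping.lookup \<alpha> i) * h i ^ nat (int k - Poly_Mapping.lookup \<alpha> i)))
    = laurent_eval f (\<lambda>i\<in>I. y i / h i) * (\<Prod>i\<in>I. (y i * h i) ^ k)"
  unfolding laurent_eval_def sum_distrib_right
proof (rule sum.cong[OF refl])
  fix \<alpha> assume \<alpha>: "\<alpha> \<in> Poly_Mapping.keys f"
  have e: "y i ^ nat (int k + a) * h i ^ nat (int k - a) = (y i / h i) powi a * (y i * h i) ^ k"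
    if i: "i \<in> I" and a: "\<bar>a\<bar> < int k" for i a
  proof -
    have "y i ^ nat (int k + a) * h i ^ nat (int k - a)
        = y i powi (int k + a) * h i powi (int k - a)"
      using a by (simp add: power_int_def)
    also have "\<dots> = y i ^ k * y i powi a * (h i ^ k / h i powi a)"
      using nz i by (simp add: power_int_add power_int_diff)
    finally show ?thesis by (simp add: power_int_divide_distrib power_mult_distrib)
  qed
  have "monom_eval \<alpha> (\<lambda>i\<in>I. y i / h i) = (\<Prod>i\<in>I. (y i / h i) powi Poly_Mapping.lookup \<alpha> i)"
    using f \<alpha> I by (subst monom_eval_superset[of I]) (auto simp: laurent_polys_def)
  then show "Poly_Mapping.lookup f \<alpha> * (\<Prod>i\<in>I. y i ^ nat (int k + Poly_Mapping.lookup \<alpha> i) *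
        h i ^ nat (int k - Poly_Mapping.lookup \<alpha> i))
      = Poly_Mapping.lookup f \<alpha> * monom_eval \<alpha> (\<lambda>i\<in>I. y i / h i) * (\<Prod>i\<in>I. (y i * h i) ^ k)"
    using k \<alpha> by (simp add: e prod.distrib[symmetric] mult.assoc)
qed

text \<open>This is \<open>f(N/H)\<close> times the product of all \<open>(N i * H i) ^ k\<close>,
  written without division so that it stays in the Laurent polynomial ring.\<close>

definition clear_denominators :: "('i, 'k::field) laurent \<Rightarrow> 'i set \<Rightarrow> nat \<Rightarrow>
    ('i \<Rightarrow> ('j::linorder, 'k) laurent) \<Rightarrow> ('i \<Rightarrow> ('j, 'k) laurent) \<Rightarrow> ('j, 'k) laurent" where
  "clear_denominators f I k N H = (\<Sum>\<alpha>\<in>Poly_Mapping.keys f.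
     Poly_Mapping.single 0 (Poly_Mapping.lookup f \<alpha>) *
     (\<Prod>i\<in>I. N i ^ nat (int k + Poly_Mapping.lookup \<alpha> i) * H i ^ nat (int k - Poly_Mapping.lookup \<alpha> i)))"

context
  fixes f :: "('i, 'k::field) laurent" and I :: "'i set" and k :: nat
    and N H :: "'i \<Rightarrow> ('j::linorder, 'k) laurent" and J :: "'j set"
  assumes inf: "infinite (UNIV :: 'k set)" and f: "f \<in> laurent_polys I" and I: "finite I"
    and k: "\<forall>\<alpha>\<in>Poly_Mapping.keys f. \<forall>i\<in>I. \<bar>Poly_Mapping.lookup \<alpha> i\<bar> < int k"
    and NJ: "\<And>i. i \<in> I \<Longrightarrow> N i \<in> laurent_polys J" and HJ: "\<And>i. i \<in> I \<Longrightarrow> H i \<in> laurent_polys J"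
begin

lemma clear_denominators_in_laurent_polys: "clear_denominators f I k N H \<in> laurent_polys J"
  unfolding clear_denominators_def
  by (intro laurent_polys_sum laurent_polys_mult laurent_polys_single laurent_polys_prod
      laurent_polys_power NJ HJ) simp_all

lemma laurent_eval_clear_denominators:
  assumes x: "x \<in> torus J"
    and nz: "\<And>i. i \<in> I \<Longrightarrow> laurent_eval (N i) x \<noteq> 0" "\<And>i. i \<in> I \<Longrightarrow> laurent_eval (H i) x \<noteq> 0"
  shows "laurent_eval (clear_denominators f I k N H) x =
    laurent_eval f (\<lambda>i\<in>I. laurent_eval (N i) x / laurent_eval (H i) x) *
    (\<Prod>i\<in>I. (laurent_eval (N i) x * laurent_eval (H i) x) ^ k)"
proof -
  have "laurent_eval (clear_denominators f I k N H) x = (\<Sum>\<alpha>\<in>Poly_Mapping.keys f.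
      Poly_Mapping.lookup f \<alpha> * (\<Prod>i\<in>I. laurent_eval (N i) x ^ nat (int k + Poly_Mapping.lookup \<alpha> i) *
        laurent_eval (H i) x ^ nat (int k - Poly_Mapping.lookup \<alpha> i)))"
    unfolding clear_denominators_def
    by (simp add: laurent_eval_sum laurent_eval_mult[OF x] laurent_eval_prod[OF x]
        laurent_eval_power[OF x] laurent_polys_mult laurent_polys_prod laurent_polys_power
        laurent_polys_single laurent_eval_single NJ HJ)
  then show ?thesis using clear_denominators_field[OF f I k] nz by simp
qed

text \<open>\<open>g\<close> marks an open set on which the fractions may be evaluated. Its product
  with the cleared polynomial vanishes on the whole torus, hence is zero, and the ring has no zero
  divisors.\<close>

lemma clear_denominators_eq_zero:
  assumes g: "g \<in> laurent_polys J" "g \<noteq> 0"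
    and zero: "\<And>x. x \<in> torus J \<Longrightarrow> laurent_eval g x \<noteq> 0 \<Longrightarrow>
      (\<forall>i\<in>I. laurent_eval (N i) x \<noteq> 0 \<and> laurent_eval (H i) x \<noteq> 0) \<and>
      laurent_eval f (\<lambda>i\<in>I. laurent_eval (N i) x / laurent_eval (H i) x) = 0"
  shows "clear_denominators f I k N H = 0"
proof -
  have "g * clear_denominators f I k N H = 0"
  proof (rule laurent_eval_eq_zeroD[OF inf laurent_polys_mult[OF g(1)
          clear_denominators_in_laurent_polys]])
    fix x :: "'j \<Rightarrow> 'k" assume x: "x \<in> torus J"
    show "laurent_eval (g * clear_denominators f I k N H) x = 0"
    proof (cases "laurent_eval g x = 0")
      case False
      then show ?thesis
        using zero[OF x] laurent_eval_clear_denominators[OF x]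
        by (simp add: laurent_eval_mult[OF x g(1) clear_denominators_in_laurent_polys])
    qed (simp add: laurent_eval_mult[OF x g(1) clear_denominators_in_laurent_polys])
  qed
  then show ?thesis using g by simp
qed

end

text \<open>The difficulty is a domain point where the given fractions \<open>N / H\<close> break
  down and other fractions \<open>N' / H'\<close> compute the value. The equation holds for
  \<open>N / H\<close> where nothing vanishes, passes to \<open>N' / H'\<close> there, becomes a
  ring identity after clearing, and can then be evaluated at the point.\<close>

lemma ratmap_image_subset_zero_locus:
  fixes \<phi> :: "'i \<Rightarrow> ('j::linorder, 'k::field) laurent fract"
  assumes inf: "infinite (UNIV :: 'k set)" and I: "finite I" and F: "F \<subseteq> laurent_polys I"
    and frac: "\<And>i. i \<in> I \<Longrightarrow> is_fraction J (\<phi> i) (N i) (H i)"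
    and N: "\<And>i. i \<in> I \<Longrightarrow> N i \<noteq> 0"
    and zero: "\<And>x f. x \<in> torus J \<Longrightarrow> f \<in> F \<Longrightarrow>
      \<forall>i\<in>I. laurent_eval (N i) x \<noteq> 0 \<and> laurent_eval (H i) x \<noteq> 0 \<Longrightarrow>
      laurent_eval f (\<lambda>i\<in>I. laurent_eval (N i) x / laurent_eval (H i) x) = 0"
  shows "ratmap_eval J I \<phi> ` ratmap_domain J I \<phi> \<subseteq> zero_locus I F"
proof clarify
  fix x assume dom: "x \<in> ratmap_domain J I \<phi>"
  then have x: "x \<in> torus J" by (simp add: ratmap_domain_def)
  have "\<forall>i\<in>I. \<exists>N' H'. is_fraction J (\<phi> i) N' H' \<and> laurent_eval H' x \<noteq> 0"
    using dom by (auto simp: ratmap_domain_def regular_at_def)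
  then obtain N' H' where frac': "\<And>i. i \<in> I \<Longrightarrow> is_fraction J (\<phi> i) (N' i) (H' i)"
    and H'x: "\<And>i. i \<in> I \<Longrightarrow> laurent_eval (H' i) x \<noteq> 0" by metis
  have val: "ratfun_eval J (\<phi> i) x = laurent_eval (N' i) x / laurent_eval (H' i) x" if "i \<in> I" for i
    using ratfun_eval_eq[OF x frac' H'x] that by blast
  have nz: "ratfun_eval J (\<phi> i) x \<noteq> 0" if "i \<in> I" for i
    using dom that by (auto simp: ratmap_domain_def)
  have N'x: "laurent_eval (N' i) x \<noteq> 0" if "i \<in> I" for i
    using nz[OF that] val[OF that] by auto
  have polys: "N i \<in> laurent_polys J" "H i \<in> laurent_polys J" "N' i \<in> laurent_polys J"
      "H' i \<in> laurent_polys J" "H i \<noteq> 0" "H' i \<noteq> 0" "N i * H' i = N' i * H i" if "i \<in> I" for i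
    using frac[OF that] frac'[OF that] by (auto simp: is_fraction_def eq_fract)
  have N': "N' i \<noteq> 0" if "i \<in> I" for i using N'x[OF that] by auto
  have eval: "ratmap_eval J I \<phi> x = (\<lambda>i\<in>I. laurent_eval (N' i) x / laurent_eval (H' i) x)"
    unfolding ratmap_eval_def by (rule restrict_ext) (rule val)
  have "laurent_eval f (ratmap_eval J I \<phi> x) = 0" if f: "f \<in> F" for f
  proof -
    have fI: "f \<in> laurent_polys I" using F f by blast
    obtain k where k: "\<forall>\<alpha>\<in>Poly_Mapping.keys f. \<forall>i\<in>I. \<bar>Poly_Mapping.lookup \<alpha> i\<bar> < int k"
      using ex_exponent_bound[OF I] by blast
    define g where "g = (\<Prod>i\<in>I. (N i * H i) * (N' i * H' i))"
    have "clear_denominators f I k N' H' = 0"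
    proof (rule clear_denominators_eq_zero[where N = N' and H = H' and g = g, OF inf fI I k polys(3,4)])
      show "g \<in> laurent_polys J" unfolding g_def by (intro laurent_polys_prod laurent_polys_mult polys)
      show "g \<noteq> 0" using I N N' polys by (simp add: g_def)
      fix z :: "'j \<Rightarrow> 'k" assume z: "z \<in> torus J" and "laurent_eval g z \<noteq> 0"
      then have gz: "laurent_eval (N i) z \<noteq> 0" "laurent_eval (H i) z \<noteq> 0"
        "laurent_eval (N' i) z \<noteq> 0" "laurent_eval (H' i) z \<noteq> 0" if "i \<in> I" for i
        using that I unfolding g_def
        by (auto simp: laurent_eval_prod[OF z] laurent_eval_mult[OF z] polys laurent_polys_mult)
      have "laurent_eval (N' i) z / laurent_eval (H' i) z = laurent_eval (N i) z / laurent_eval (H i) z"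
        if "i \<in> I" for i
      proof -
        have "laurent_eval (N i) z * laurent_eval (H' i) z = laurent_eval (N' i) z * laurent_eval (H i) z"
          using polys[OF that] by (simp flip: laurent_eval_mult[OF z])
        then show ?thesis using gz[OF that] by (simp add: frac_eq_eq)
      qed
      then have eq: "(\<lambda>i\<in>I. laurent_eval (N' i) z / laurent_eval (H' i) z)
          = (\<lambda>i\<in>I. laurent_eval (N i) z / laurent_eval (H i) z)" by (rule restrict_ext)
      show "(\<forall>i\<in>I. laurent_eval (N' i) z \<noteq> 0 \<and> laurent_eval (H' i) z \<noteq> 0) \<and>
          laurent_eval f (\<lambda>i\<in>I. laurent_eval (N' i) z / laurent_eval (H' i) z) = 0"
        unfolding eq by (intro conjI ballI zero[OF z f] gz)
    qed
    \<comment> \<open>Neither \<open>N'\<close> nor \<open>H'\<close> vanishes at \<open>x\<close>,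
      so the clearing factor can be cancelled there.\<close>
    then have "laurent_eval f (ratmap_eval J I \<phi> x) *
        (\<Prod>i\<in>I. (laurent_eval (N' i) x * laurent_eval (H' i) x) ^ k) = 0"
      using laurent_eval_clear_denominators[where N = N' and H = H', OF inf fI I k polys(3,4) x N'x H'x] eval by simp
    then show ?thesis using N'x H'x I by simp
  qed
  moreover have "ratmap_eval J I \<phi> x \<in> torus I"
    unfolding ratmap_eval_def torus_def using nz by (intro restrict_PiE_iff[THEN iffD2]) simp
  ultimately show "ratmap_eval J I \<phi> x \<in> zero_locus I F"
    by (simp add: zero_locus_def)
qed

subsection \<open>Tropicalization as a valuation\<close>

text \<open>For the zero polynomial \<open>trop_poly\<close> is a minimum over the empty set; the
  value infinity makes sums and products obey the valuation rules without case distinctions.\<close>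

definition laurent_val ::
  "('k::field \<Rightarrow> ereal) \<Rightarrow> ('j \<Rightarrow> real) \<Rightarrow> ('j, 'k) laurent \<Rightarrow> ereal" where
  "laurent_val v \<zeta> f = (if f = 0 then \<infinity> else ereal (trop_poly v f \<zeta>))"

lemma laurent_val_eq_ereal_iff:
  "laurent_val v \<zeta> f = ereal m \<longleftrightarrow> f \<noteq> 0 \<and> trop_poly v f \<zeta> = m"
  by (auto simp: laurent_val_def)

context
  fixes v :: "'k::field \<Rightarrow> ereal"
  assumes v: "nonarch_valuation v"
begin

lemma val_one: "v 1 = 0"
proof -
  obtain a where a: "v 1 = ereal a" using val_finite[OF v, of 1] by auto
  then show ?thesis using val_mult[OF v, of 1 1] by simp
qed

lemma ereal_term_weight:
  assumes "\<alpha> \<in> Poly_Mapping.keys f"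
  shows "v (Poly_Mapping.lookup f \<alpha>) + ereal (exponent_pairing \<zeta> \<alpha>) = ereal (term_weight v f \<zeta> \<alpha>)"
  using val_finite[OF v, of "Poly_Mapping.lookup f \<alpha>"] assms
  by (auto simp: term_weight_def in_keys_iff)

text \<open>Coefficients outside the support have valuation infinity and impose nothing. Lower
  bounds can thus be checked at every exponent, without tracking how supports change under
  addition.\<close>

lemma laurent_val_ge_iff:
  "m \<le> laurent_val v \<zeta> f \<longleftrightarrow>
     (\<forall>\<alpha>. m \<le> v (Poly_Mapping.lookup f \<alpha>) + ereal (exponent_pairing \<zeta> \<alpha>))"
proof (cases "f = 0")
  case False
  let ?W = "term_weight v f \<zeta> ` Poly_Mapping.keys f"
  have W: "finite ?W" "?W \<noteq> {}" using False by auto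
  have "(\<forall>\<alpha>. m \<le> v (Poly_Mapping.lookup f \<alpha>) + ereal (exponent_pairing \<zeta> \<alpha>))
      \<longleftrightarrow> (\<forall>\<alpha>\<in>Poly_Mapping.keys f. m \<le> ereal (term_weight v f \<zeta> \<alpha>))"
  proof (intro iffI allI ballI)
    fix \<alpha> assume *: "\<forall>\<alpha>\<in>Poly_Mapping.keys f. m \<le> ereal (term_weight v f \<zeta> \<alpha>)"
    show "m \<le> v (Poly_Mapping.lookup f \<alpha>) + ereal (exponent_pairing \<zeta> \<alpha>)"
    proof (cases "\<alpha> \<in> Poly_Mapping.keys f")
      case True
      then show ?thesis using * by (simp add: ereal_term_weight)
    qed (simp add: in_keys_iff val_zero[OF v])
  qed (metis ereal_term_weight)
  also have "\<dots> \<longleftrightarrow> m \<le> ereal (Min ?W)"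
    using W by (cases m) auto
  finally show ?thesis using False by (simp add: laurent_val_def trop_poly_def)
qed (simp add: laurent_val_def val_zero[OF v])

lemma laurent_val_attained:
  assumes "f \<noteq> 0"
  shows "\<exists>\<alpha>\<in>Poly_Mapping.keys f. trop_poly v f \<zeta> = term_weight v f \<zeta> \<alpha>"
proof -
  have "trop_poly v f \<zeta> \<in> term_weight v f \<zeta> ` Poly_Mapping.keys f"
    unfolding trop_poly_def using assms by (intro Min_in) auto
  then show ?thesis by auto
qed

lemma laurent_val_sum_ge:
  assumes "\<And>a. a \<in> A \<Longrightarrow> m \<le> laurent_val v \<zeta> (F a)"
  shows "m \<le> laurent_val v \<zeta> (sum F A)"
  unfolding laurent_val_ge_iff
proof
  fix \<alpha>
  have "m - ereal (exponent_pairing \<zeta> \<alpha>) \<le> v (\<Sum>a\<in>A. Poly_Mapping.lookup (F a) \<alpha>)"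
    by (rule val_sum_ge[OF v])
       (use assms in \<open>auto simp: laurent_val_ge_iff ereal_minus_le_iff add.commute\<close>)
  then show "m \<le> v (Poly_Mapping.lookup (sum F A) \<alpha>) + ereal (exponent_pairing \<zeta> \<alpha>)"
    by (simp add: ereal_minus_le_iff lookup_sum add.commute)
qed

text \<open>At an exponent where \<open>F a\<close> attains its minimum, the other coefficients
  together have strictly larger valuation, so the coefficient of the sum has the valuation of that
  of \<open>F a\<close>.\<close>

lemma laurent_val_sum_dominant:
  assumes A: "finite A" "a \<in> A" and nz: "F a \<noteq> 0"
    and less: "\<And>b. b \<in> A - {a} \<Longrightarrow> laurent_val v \<zeta> (F a) < laurent_val v \<zeta> (F b)"
  shows "laurent_val v \<zeta> (sum F A) = laurent_val v \<zeta> (F a)"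
proof (rule antisym)
  show "laurent_val v \<zeta> (F a) \<le> laurent_val v \<zeta> (sum F A)"
    by (rule laurent_val_sum_ge) (use less in force)
  obtain \<alpha> where \<alpha>: "\<alpha> \<in> Poly_Mapping.keys (F a)"
    and m: "laurent_val v \<zeta> (F a) = ereal (term_weight v (F a) \<zeta> \<alpha>)"
    using laurent_val_attained[OF nz] nz by (auto simp: laurent_val_def)
  let ?l = "\<lambda>b. Poly_Mapping.lookup (F b) \<alpha>"
  obtain r where r: "v (?l a) = ereal r"
    using \<alpha> val_finite[OF v] by (auto simp: in_keys_iff)
  have rm: "laurent_val v \<zeta> (F a) = ereal (r + exponent_pairing \<zeta> \<alpha>)"
    unfolding m ereal_term_weight[OF \<alpha>, symmetric] r by simp
  have "v (?l a) < v (\<Sum>b\<in>A - {a}. ?l b)"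
  proof (rule val_sum_gr[OF v])
    fix b assume "b \<in> A - {a}"
    then have "laurent_val v \<zeta> (F a) < laurent_val v \<zeta> (F b)" by (rule less)
    also have "\<dots> \<le> v (?l b) + ereal (exponent_pairing \<zeta> \<alpha>)"
      using laurent_val_ge_iff by blast
    finally show "v (?l a) < v (?l b)"
      unfolding rm r by (cases "v (?l b)") auto
  qed (simp add: r)
  moreover have "Poly_Mapping.lookup (sum F A) \<alpha> = ?l a + (\<Sum>b\<in>A - {a}. ?l b)"
    unfolding lookup_sum by (rule sum.remove[OF A])
  ultimately have "v (Poly_Mapping.lookup (sum F A) \<alpha>) = ereal r"
    using val_add_dominant[OF v] r by metis
  then show "laurent_val v \<zeta> (sum F A) \<le> laurent_val v \<zeta> (F a)"
    using laurent_val_ge_iff[of "laurent_val v \<zeta> (sum F A)" \<zeta> "sum F A"]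
    by (metis order_refl plus_ereal.simps(1) rm)
qed

lemma laurent_val_uminus: "laurent_val v \<zeta> (- f) = laurent_val v \<zeta> f"
proof -
  have "m \<le> laurent_val v \<zeta> (- f) \<longleftrightarrow> m \<le> laurent_val v \<zeta> f" for m
    unfolding laurent_val_ge_iff by (simp add: val_minus[OF v])
  then show ?thesis by (meson order_antisym order_refl)
qed

lemma laurent_val_add_dominant:
  assumes "laurent_val v \<zeta> f < laurent_val v \<zeta> g"
  shows "laurent_val v \<zeta> (f + g) = laurent_val v \<zeta> f"
proof -
  have "laurent_val v \<zeta> (\<Sum>b\<in>UNIV. if b then f else g) = laurent_val v \<zeta> (if True then f else g)"
    by (rule laurent_val_sum_dominant) (use assms in \<open>auto simp: laurent_val_def\<close>)
  then show ?thesis by (simp add: UNIV_bool add.commute)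
qed

lemma laurent_val_mult:
  fixes f g :: "('j::linorder, 'k) laurent"
  shows "laurent_val v \<zeta> (f * g) = laurent_val v \<zeta> f + laurent_val v \<zeta> g"
  by (auto simp: laurent_val_def trop_poly_mult[OF v])

lemma trop_poly_single:
  assumes "c \<noteq> 0"
  shows "trop_poly v (Poly_Mapping.single \<alpha> c) \<zeta> = real_of_ereal (v c) + exponent_pairing \<zeta> \<alpha>"
  using assms by (simp add: trop_poly_def term_weight_def)

lemma trop_poly_one: "trop_poly v 1 \<zeta> = 0"
  using trop_poly_single[of 1 0 \<zeta>] by (simp add: val_one exponent_pairing_def)

lemma trop_poly_power:
  fixes f :: "('j::linorder, 'k) laurent"
  assumes "f \<noteq> 0"
  shows "trop_poly v (f ^ m) \<zeta> = real m * trop_poly v f \<zeta>"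
  using assms by (induction m) (auto simp: trop_poly_one trop_poly_mult[OF v] algebra_simps)

lemma trop_poly_prod:
  fixes F :: "'a \<Rightarrow> ('j::linorder, 'k) laurent"
  assumes "\<And>a. a \<in> A \<Longrightarrow> F a \<noteq> 0"
  shows "trop_poly v (prod F A) \<zeta> = (\<Sum>a\<in>A. trop_poly v (F a) \<zeta>)"
  using assms
  by (induction A rule: infinite_finite_induct) (auto simp: trop_poly_one trop_poly_mult[OF v])

text \<open>Substituting the map into \<open>f\<close> and clearing denominators gives a sum that is
  zero in the ring. Its summands have the weights of the terms of \<open>f\<close> at the image
  point, all shifted by one constant. A unique smallest weight would force the sum to have finite
  valuation.\<close>

lemma trop_map_mem_trop_variety:
  fixes \<phi> :: "'i \<Rightarrow> ('j::linorder, 'k) laurent fract" and X :: "('i \<Rightarrow> 'k) set"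
  assumes inf: "infinite (UNIV :: 'k set)" and I: "finite I"
    and \<phi>: "rational_map J I \<phi>" and X: "ratmap_eval J I \<phi> ` ratmap_domain J I \<phi> \<subseteq> X"
  shows "trop_map v J I \<phi> \<zeta> \<in> trop_variety v I X"
proof -
  define \<xi> where "\<xi> = trop_map v J I \<phi> \<zeta>"
  have "\<forall>i\<in>I. \<exists>N H. is_fraction J (\<phi> i) N H \<and> N \<noteq> 0"
    using \<phi> by (force simp: rational_map_def rational_functions_def is_fraction_def fract_collapse)
  then obtain N H where frac: "\<And>i. i \<in> I \<Longrightarrow> is_fraction J (\<phi> i) (N i) (H i)"
    and N: "\<And>i. i \<in> I \<Longrightarrow> N i \<noteq> 0" by metis
  have H: "H i \<noteq> 0" and NJ: "N i \<in> laurent_polys J" and HJ: "H i \<in> laurent_polys J" if "i \<in> I" for i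
    using frac[OF that] by (auto simp: is_fraction_def)
  have \<xi>: "\<xi> i = trop_poly v (N i) \<zeta> - trop_poly v (H i) \<zeta>" if "i \<in> I" for i
    using trop_ratfun_eq[OF v frac[OF that] N[OF that]] that by (simp add: \<xi>_def trop_map_def)
  have \<xi>I: "\<xi> \<in> I \<rightarrow>\<^sub>E UNIV" by (simp add: \<xi>_def trop_map_def)
  have "\<xi> \<in> corner_locus v I f" if f: "f \<in> vanishing_ideal I X" "f \<noteq> 0" for f
  proof (rule ccontr)
    assume notin: "\<xi> \<notin> corner_locus v I f"
    have fI: "f \<in> laurent_polys I" and fX: "\<And>x. x \<in> X \<Longrightarrow> laurent_eval f x = 0"
      using f by (auto simp: vanishing_ideal_def)
    obtain k where k: "\<forall>\<alpha>\<in>Poly_Mapping.keys f. \<forall>i\<in>I. \<bar>Poly_Mapping.lookup \<alpha> i\<bar> < int k"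
      using ex_exponent_bound[OF I] by blast
    define P where "P \<alpha> = (\<Prod>i\<in>I. N i ^ nat (int k + Poly_Mapping.lookup \<alpha> i) *
      H i ^ nat (int k - Poly_Mapping.lookup \<alpha> i))" for \<alpha>
    define F where "F \<alpha> = Poly_Mapping.single 0 (Poly_Mapping.lookup f \<alpha>) * P \<alpha>" for \<alpha>
    \<comment> \<open>Where no \<open>N i\<close> or \<open>H i\<close> vanishes, these fractions
      define the map, and it lands in \<open>X\<close>, on which \<open>f\<close> is zero.\<close>
    have "clear_denominators f I k N H = 0"
    proof (rule clear_denominators_eq_zero[OF inf fI I k NJ HJ, where g = "\<Prod>i\<in>I. N i * H i"])
      show "(\<Prod>i\<in>I. N i * H i) \<in> laurent_polys J"
        by (intro laurent_polys_prod laurent_polys_mult NJ HJ)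
      show "(\<Prod>i\<in>I. N i * H i) \<noteq> 0" using I N H by simp
      fix x :: "'j \<Rightarrow> 'k" assume x: "x \<in> torus J" and "laurent_eval (\<Prod>i\<in>I. N i * H i) x \<noteq> 0"
      then have nz: "laurent_eval (N i) x \<noteq> 0" "laurent_eval (H i) x \<noteq> 0" if "i \<in> I" for i
        using that I by (auto simp: laurent_eval_prod[OF x] laurent_eval_mult[OF x] NJ HJ
            laurent_polys_mult)
      have val: "ratfun_eval J (\<phi> i) x = laurent_eval (N i) x / laurent_eval (H i) x"
        if "i \<in> I" for i
        using ratfun_eval_eq[OF x frac nz(2)] that by blast
      have "x \<in> ratmap_domain J I \<phi>"
        unfolding ratmap_domain_def
      proof (intro CollectI conjI ballI x)
        fix i assume i: "i \<in> I"
        show "regular_at J (\<phi> i) x"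
          unfolding regular_at_def using frac[OF i] nz[OF i] by blast
        show "ratfun_eval J (\<phi> i) x \<noteq> 0" unfolding val[OF i] using nz[OF i] by simp
      qed
      then have "ratmap_eval J I \<phi> x \<in> X" using X by blast
      moreover have "ratmap_eval J I \<phi> x = (\<lambda>i\<in>I. laurent_eval (N i) x / laurent_eval (H i) x)"
        unfolding ratmap_eval_def by (rule restrict_ext) (rule val)
      ultimately have "laurent_eval f (\<lambda>i\<in>I. laurent_eval (N i) x / laurent_eval (H i) x) = 0"
        using fX by simp
      then show "(\<forall>i\<in>I. laurent_eval (N i) x \<noteq> 0 \<and> laurent_eval (H i) x \<noteq> 0) \<and>
          laurent_eval f (\<lambda>i\<in>I. laurent_eval (N i) x / laurent_eval (H i) x) = 0"
        using nz by blast
    qed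
    then have "sum F (Poly_Mapping.keys f) = 0"
      by (simp add: clear_denominators_def F_def P_def)
    \<comment> \<open>The valuation of the clearing factor, the product of all
      \<open>(N i * H i) ^ k\<close>.\<close>
    moreover define c where "c = (\<Sum>i\<in>I. real k * (trop_poly v (N i) \<zeta> + trop_poly v (H i) \<zeta>))"
    have valF: "laurent_val v \<zeta> (F \<alpha>) = ereal (term_weight v f \<xi> \<alpha> + c)"
      if \<alpha>: "\<alpha> \<in> Poly_Mapping.keys f" for \<alpha>
    proof -
      let ?a = "Poly_Mapping.lookup \<alpha>"
      have nz: "Poly_Mapping.lookup f \<alpha> \<noteq> 0" using \<alpha> by (simp add: in_keys_iff)
      have P0: "P \<alpha> \<noteq> 0" using N H I by (simp add: P_def)
      have "trop_poly v (P \<alpha>) \<zeta> = (\<Sum>i\<in>I. real (nat (int k + ?a i)) * trop_poly v (N i) \<zeta> +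
          real (nat (int k - ?a i)) * trop_poly v (H i) \<zeta>)"
        unfolding P_def using N H
        by (subst trop_poly_prod) (auto simp: trop_poly_mult[OF v] trop_poly_power)
      also have "\<dots> = (\<Sum>i\<in>I. \<xi> i * of_int (?a i) +
          real k * (trop_poly v (N i) \<zeta> + trop_poly v (H i) \<zeta>))"
      proof (rule sum.cong[OF refl])
        fix i assume i: "i \<in> I"
        have "\<bar>?a i\<bar> < int k" using k \<alpha> i by blast
        then have "real (nat (int k + ?a i)) = real k + of_int (?a i)"
          "real (nat (int k - ?a i)) = real k - of_int (?a i)" by auto
        then show "real (nat (int k + ?a i)) * trop_poly v (N i) \<zeta> +
          real (nat (int k - ?a i)) * trop_poly v (H i) \<zeta> = \<xi> i * of_int (?a i) +
          real k * (trop_poly v (N i) \<zeta> + trop_poly v (H i) \<zeta>)"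
          by (simp add: \<xi>[OF i] algebra_simps)
      qed
      also have "\<dots> = exponent_pairing \<xi> \<alpha> + c"
        using fI \<alpha> exponent_pairing_superset[OF I, of \<alpha> \<xi>]
        by (auto simp: sum.distrib c_def laurent_polys_def)
      finally have "trop_poly v (F \<alpha>) \<zeta> = term_weight v f \<xi> \<alpha> + c"
        unfolding F_def term_weight_def using nz P0
        by (subst trop_poly_mult[OF v])
           (auto simp: trop_poly_single exponent_pairing_def single_eq_0_iff)
      moreover have "F \<alpha> \<noteq> 0" using nz P0 by (simp add: F_def single_eq_0_iff)
      ultimately show ?thesis by (simp add: laurent_val_eq_ereal_iff)
    qed
    obtain \<alpha> where \<alpha>: "\<alpha> \<in> Poly_Mapping.keys f" "trop_poly v f \<xi> = term_weight v f \<xi> \<alpha>"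
      using laurent_val_attained f by blast
    have less: "term_weight v f \<xi> \<alpha> < term_weight v f \<xi> \<beta>" if "\<beta> \<in> Poly_Mapping.keys f - {\<alpha>}" for \<beta>
    proof -
      have "trop_poly v f \<xi> \<le> term_weight v f \<xi> \<beta>" using that by (simp add: trop_poly_def)
      moreover have "term_weight v f \<xi> \<beta> \<noteq> trop_poly v f \<xi>"
        using notin that \<alpha> \<xi>I by (auto simp: corner_locus_def)
      ultimately show ?thesis using \<alpha> by simp
    qed
    have "laurent_val v \<zeta> (sum F (Poly_Mapping.keys f)) = laurent_val v \<zeta> (F \<alpha>)"
    proof (rule laurent_val_sum_dominant[OF finite_keys \<alpha>(1)])
      show "F \<alpha> \<noteq> 0" using valF[OF \<alpha>(1)] unfolding laurent_val_eq_ereal_iff by blast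
      fix \<beta> assume \<beta>: "\<beta> \<in> Poly_Mapping.keys f - {\<alpha>}"
      then show "laurent_val v \<zeta> (F \<alpha>) < laurent_val v \<zeta> (F \<beta>)"
        using less[OF \<beta>] valF[of \<alpha>] valF[of \<beta>] \<alpha>(1) by simp
    qed
    ultimately show False using valF[OF \<alpha>(1)] by (simp add: laurent_val_def)
  qed
  then show ?thesis using \<xi>I by (auto simp: trop_variety_def \<xi>_def)
qed

end

subsection \<open>Leibniz expansions\<close>

text \<open>\<open>a (k, l)\<close> is the variable in position \<open>(k, l)\<close> of the matrix; it is the identity for the
  matrix torus itself and \<open>entry_idx n\<close> for the parameter torus.\<close>

definition perm_expo :: "(nat \<times> nat \<Rightarrow> 'i) \<Rightarrow> nat \<Rightarrow> (nat \<Rightarrow> nat) \<Rightarrow> 'i \<Rightarrow>\<^sub>0 int" where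
  "perm_expo a n \<pi> = (\<Sum>k<n. Poly_Mapping.single (a (k, \<pi> k)) 1)"

text \<open>A partial Leibniz expansion. All permutations give the determinant, those with
  \<open>\<pi> k = l\<close> give the entry times its cofactor, and the remaining ones give the part
  of the determinant free of that entry.\<close>

definition perm_poly ::
  "(nat \<times> nat \<Rightarrow> 'i) \<Rightarrow> nat \<Rightarrow> (nat \<Rightarrow> nat) set \<Rightarrow> ('i, 'k::field) laurent" where
  "perm_poly a n S = (\<Sum>\<pi>\<in>S. Poly_Mapping.single (perm_expo a n \<pi>) (signof \<pi>))"

abbreviation perms :: "nat \<Rightarrow> (nat \<Rightarrow> nat) set" where
  "perms n \<equiv> {\<pi>. \<pi> permutes {0..<n}}"

definition perm_weight :: "(nat \<times> nat \<Rightarrow> real) \<Rightarrow> nat \<Rightarrow> (nat \<Rightarrow> nat) \<Rightarrow> real" where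
  "perm_weight \<xi> n \<pi> = (\<Sum>k<n. \<xi> (k, \<pi> k))"

lemma finite_perms: "finite (perms n)"
  by (simp add: finite_permutations)

lemma perms_less: "\<pi> \<in> perms n \<Longrightarrow> k < n \<Longrightarrow> \<pi> k < n"
  by (auto dest: permutes_in_image[of _ _ k])

lemma lookup_perm_expo:
  assumes "inj_on a ({..<n} \<times> {..<n})" "\<pi> \<in> perms n" "k < n" "l < n"
  shows "Poly_Mapping.lookup (perm_expo a n \<pi>) (a (k, l)) = (if \<pi> k = l then 1 else 0)"
proof -
  have eq: "a (k', \<pi> k') = a (k, l) \<longleftrightarrow> k' = k \<and> \<pi> k = l" if "k' < n" for k'
    using inj_on_eq_iff[OF assms(1), of "(k', \<pi> k')" "(k, l)"] perms_less[OF assms(2)] assms(3,4)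
      that by auto
  have "Poly_Mapping.lookup (perm_expo a n \<pi>) (a (k, l))
      = (\<Sum>k'<n. if k' = k then if \<pi> k = l then 1 else 0 else 0)"
    unfolding perm_expo_def lookup_sum lookup_single when_def
    by (rule sum.cong) (auto simp: eq)
  then show ?thesis using assms(3) by simp
qed

lemma keys_perm_expo: "Poly_Mapping.keys (perm_expo a n \<pi>) \<subseteq> (\<lambda>k. a (k, \<pi> k)) ` {..<n}"
proof
  fix i assume "i \<in> Poly_Mapping.keys (perm_expo a n \<pi>)"
  then have "(\<Sum>k<n. Poly_Mapping.lookup (Poly_Mapping.single (a (k, \<pi> k)) (1::int)) i) \<noteq> 0"
    by (simp add: in_keys_iff perm_expo_def lookup_sum)
  then obtain k where "k < n" "Poly_Mapping.lookup (Poly_Mapping.single (a (k, \<pi> k)) (1::int)) i \<noteq> 0"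
    by (meson lessThan_iff sum.not_neutral_contains_not_neutral)
  then show "i \<in> (\<lambda>k. a (k, \<pi> k)) ` {..<n}" by (auto simp: lookup_single when_def split: if_splits)
qed

text \<open>The monomial determines the permutation, since the variable at (k, l) occurs in it
  exactly when \<open>\<pi> k = l\<close>. Distinct Leibniz terms therefore never merge.\<close>

lemma inj_on_perm_expo:
  assumes a: "inj_on a ({..<n} \<times> {..<n})"
  shows "inj_on (perm_expo a n) (perms n)"
proof (rule inj_onI)
  fix \<pi> \<sigma> assume \<pi>: "\<pi> \<in> perms n" and \<sigma>: "\<sigma> \<in> perms n" and eq: "perm_expo a n \<pi> = perm_expo a n \<sigma>"
  show "\<pi> = \<sigma>"
  proof
    fix k
    show "\<pi> k = \<sigma> k"
    proof (cases "k < n")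
      case True
      have "Poly_Mapping.lookup (perm_expo a n \<sigma>) (a (k, \<pi> k)) = 1"
        unfolding eq[symmetric] using lookup_perm_expo[OF a \<pi> True perms_less[OF \<pi> True]] by simp
      then show ?thesis
        using lookup_perm_expo[OF a \<sigma> True perms_less[OF \<pi> True]] by (simp split: if_splits)
    next
      case False
      then show ?thesis using \<pi> \<sigma> by (simp add: permutes_not_in)
    qed
  qed
qed

lemma exponent_pairing_single: "exponent_pairing \<zeta> (Poly_Mapping.single i e) = \<zeta> i * of_int e"
  by (simp add: exponent_pairing_def)

lemma exponent_pairing_sum: "exponent_pairing \<zeta> (sum \<alpha> A) = (\<Sum>a\<in>A. exponent_pairing \<zeta> (\<alpha> a))"
  by (induction A rule: infinite_finite_induct)
     (auto simp: exponent_pairing_add, simp_all add: exponent_pairing_def)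

lemma exponent_pairing_perm_expo:
  "exponent_pairing \<zeta> (perm_expo a n \<pi>) = perm_weight (\<zeta> \<circ> a) n \<pi>"
  by (simp add: perm_expo_def exponent_pairing_sum exponent_pairing_single perm_weight_def)

lemma monom_eval_single: "monom_eval (Poly_Mapping.single i e) x = x i powi e"
  by (simp add: monom_eval_def)

lemma monom_eval_sum:
  assumes "x \<in> torus I" "\<And>a. a \<in> A \<Longrightarrow> Poly_Mapping.keys (\<alpha> a) \<subseteq> I"
  shows "monom_eval (sum \<alpha> A) x = (\<Prod>a\<in>A. monom_eval (\<alpha> a) x)"
  using assms(2)
proof (induction A rule: infinite_finite_induct)
  case (insert a A)
  have "Poly_Mapping.keys (sum \<alpha> A) \<subseteq> I"
    using insert.prems Poly_Mapping.keys_sum[of \<alpha> A] by blast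
  then show ?case using insert by (simp add: monom_eval_add[OF assms(1)])
qed auto

lemma laurent_eval_perm_poly:
  assumes x: "x \<in> torus I" and a: "a ` ({..<n} \<times> {..<n}) \<subseteq> I" and S: "S \<subseteq> perms n"
  shows "laurent_eval (perm_poly a n S) x = (\<Sum>\<pi>\<in>S. signof \<pi> * (\<Prod>k<n. x (a (k, \<pi> k))))"
proof -
  have "monom_eval (perm_expo a n \<pi>) x = (\<Prod>k<n. x (a (k, \<pi> k)))" if "\<pi> \<in> S" for \<pi>
    unfolding perm_expo_def
  proof (subst monom_eval_sum[OF x])
    fix k assume "k \<in> {..<n}"
    moreover have "\<pi> \<in> perms n" using S that by blast
    ultimately show "Poly_Mapping.keys (Poly_Mapping.single (a (k, \<pi> k)) (1 :: int)) \<subseteq> I"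
      using a perms_less by auto
  qed (simp add: monom_eval_single)
  then show ?thesis by (simp add: perm_poly_def laurent_eval_sum laurent_eval_single)
qed

lemma perm_poly_in_laurent_polys:
  assumes "a ` ({..<n} \<times> {..<n}) \<subseteq> I" "S \<subseteq> perms n"
  shows "perm_poly a n S \<in> laurent_polys I"
  unfolding perm_poly_def
proof (intro laurent_polys_sum laurent_polys_single)
  fix \<pi> assume "\<pi> \<in> S"
  then show "Poly_Mapping.keys (perm_expo a n \<pi>) \<subseteq> I"
    using keys_perm_expo[of a n \<pi>] assms perms_less by fastforce
qed

lemma lookup_perm_poly:
  assumes a: "inj_on a ({..<n} \<times> {..<n})" and S: "S \<subseteq> perms n" and \<pi>: "\<pi> \<in> S"
  shows "Poly_Mapping.lookup (perm_poly a n S) (perm_expo a n \<pi>) = (signof \<pi> :: 'k::field)"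
proof -
  have "Poly_Mapping.lookup (perm_poly a n S) (perm_expo a n \<pi>)
      = (\<Sum>\<sigma>\<in>S. if \<sigma> = \<pi> then signof \<pi> else (0 :: 'k))"
    unfolding perm_poly_def lookup_sum lookup_single when_def
  proof (rule sum.cong[OF refl])
    fix \<sigma> assume "\<sigma> \<in> S"
    then have "perm_expo a n \<sigma> = perm_expo a n \<pi> \<longleftrightarrow> \<sigma> = \<pi>"
      using inj_on_eq_iff[OF inj_on_perm_expo[OF a]] S \<pi> by blast
    then show "(if perm_expo a n \<sigma> = perm_expo a n \<pi> then signof \<sigma> else 0)
        = (if \<sigma> = \<pi> then signof \<pi> else (0 :: 'k))" by simp
  qed
  then show ?thesis
    using \<pi> finite_subset[OF S finite_perms] by simp
qed

lemma signof_neq_zero: "signof \<pi> \<noteq> (0 :: 'k::field)"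
  by (simp add: sign_def)

text \<open>No term is lost: the monomials are distinct, and a sign is non-zero in every
  characteristic.\<close>

lemma keys_perm_poly:
  assumes a: "inj_on a ({..<n} \<times> {..<n})" and S: "S \<subseteq> perms n"
  shows "Poly_Mapping.keys (perm_poly a n S :: ('i, 'k::field) laurent) = perm_expo a n ` S"
proof
  show "Poly_Mapping.keys (perm_poly a n S :: ('i, 'k) laurent) \<subseteq> perm_expo a n ` S"
    unfolding perm_poly_def
    using Poly_Mapping.keys_sum[of "\<lambda>\<pi>. Poly_Mapping.single (perm_expo a n \<pi>) (signof \<pi> :: 'k)" S]
    by (auto split: if_splits)
  show "perm_expo a n ` S \<subseteq> Poly_Mapping.keys (perm_poly a n S :: ('i, 'k) laurent)"
    using lookup_perm_poly[OF a S, where 'k = 'k] signof_neq_zero[where 'k = 'k]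
    by (auto simp: in_keys_iff)
qed

context
  fixes v :: "'k::field \<Rightarrow> ereal"
  assumes v: "nonarch_valuation v"
begin

lemma val_signof: "v (signof \<pi>) = 0"
  using val_one[OF v] val_minus[OF v, of 1] by (simp add: sign_def)

lemma term_weight_perm_poly:
  assumes "inj_on a ({..<n} \<times> {..<n})" "S \<subseteq> perms n" "\<pi> \<in> S"
  shows "term_weight v (perm_poly a n S) \<zeta> (perm_expo a n \<pi>) = perm_weight (\<zeta> \<circ> a) n \<pi>"
  by (simp add: term_weight_def lookup_perm_poly[OF assms] val_signof exponent_pairing_perm_expo)

text \<open>The coefficients are signs and have valuation 0, so only the weights of the entries
  remain. For all permutations this is the tropical determinant.\<close>

lemma trop_poly_perm_poly:
  assumes "inj_on a ({..<n} \<times> {..<n})" "S \<subseteq> perms n"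
  shows "trop_poly v (perm_poly a n S) \<zeta> = Min (perm_weight (\<zeta> \<circ> a) n ` S)"
proof -
  have "term_weight v (perm_poly a n S) \<zeta> ` perm_expo a n ` S = perm_weight (\<zeta> \<circ> a) n ` S"
    unfolding image_image by (rule image_cong) (auto simp: term_weight_perm_poly[OF assms])
  then show ?thesis by (simp add: trop_poly_def keys_perm_poly[OF assms])
qed

lemma laurent_val_perm_poly:
  fixes a :: "nat \<times> nat \<Rightarrow> 'i"
  assumes a: "inj_on a ({..<n} \<times> {..<n})" "S \<subseteq> perms n"
    and m: "\<sigma> \<in> S" "perm_weight (\<zeta> \<circ> a) n \<sigma> = m" "\<And>\<pi>. \<pi> \<in> S \<Longrightarrow> m \<le> perm_weight (\<zeta> \<circ> a) n \<pi>"
  shows "laurent_val v \<zeta> (perm_poly a n S) = ereal m"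
proof -
  have "(perm_poly a n S :: ('i, 'k) laurent) \<noteq> 0"
    using keys_perm_poly[OF a, where 'k = 'k] m(1) by auto
  moreover have "Min (perm_weight (\<zeta> \<circ> a) n ` S) = m"
    using m finite_subset[OF a(2) finite_perms] by (intro Min_eqI) auto
  ultimately show ?thesis by (simp add: laurent_val_def trop_poly_perm_poly[OF a])
qed

lemma laurent_val_perm_poly_ge:
  assumes a: "inj_on a ({..<n} \<times> {..<n})" "S \<subseteq> perms n"
    and m: "\<And>\<pi>. \<pi> \<in> S \<Longrightarrow> m \<le> perm_weight (\<zeta> \<circ> a) n \<pi>"
  shows "ereal m \<le> laurent_val v \<zeta> (perm_poly a n S)"
proof (cases "S = {}")
  case True
  then show ?thesis by (simp add: perm_poly_def laurent_val_def)
next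
  case False
  have "m \<le> Min (perm_weight (\<zeta> \<circ> a) n ` S)"
    using m False finite_subset[OF a(2) finite_perms] by (subst Min_ge_iff) auto
  then show ?thesis by (simp add: laurent_val_def trop_poly_perm_poly[OF a])
qed

end

subsection \<open>The rank-one correction\<close>

definition perms_at :: "nat \<Rightarrow> nat \<Rightarrow> nat \<Rightarrow> (nat \<Rightarrow> nat) set" where
  "perms_at n k l = {\<pi> \<in> perms n. \<pi> k = l}"

lemma perms_at_subset: "perms_at n k l \<subseteq> perms n"
  by (auto simp: perms_at_def)

lemma det_eq_sum_perms:
  assumes "A \<in> carrier_mat n n"
  shows "det A = (\<Sum>\<pi>\<in>perms n. signof \<pi> * (\<Prod>i<n. A $$ (i, \<pi> i)))"
  using det_def'[OF assms] by (simp add: atLeast0LessThan)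

text \<open>The determinant of one auxiliary matrix is expanded twice, by Laplace along row
  \<open>k\<close> and by Leibniz.\<close>

lemma sum_perms_at_eq_cofactor:
  fixes A :: "'a::comm_ring_1 mat"
  assumes A: "A \<in> carrier_mat n n" and k: "k < n" and l: "l < n"
  shows "(\<Sum>\<pi>\<in>perms_at n k l. signof \<pi> * (\<Prod>i<n. A $$ (i, \<pi> i))) = A $$ (k, l) * cofactor A k l"
proof -
  \<comment> \<open>Row \<open>k\<close> keeps only its entry in column \<open>l\<close>: a single
    cofactor survives, and the minor there is unchanged because it omits row
    \<open>k\<close>.\<close>
  define B where "B = mat n n (\<lambda>(i, j). if i = k \<and> j \<noteq> l then 0 else A $$ (i, j))"
  have B: "B \<in> carrier_mat n n" by (simp add: B_def)
  have "mat_delete B k l = mat_delete A k l"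
    unfolding mat_delete_def B_def using A by (intro cong_mat) auto
  then have cof: "cofactor B k l = cofactor A k l" by (simp add: cofactor_def)
  have "det B = (\<Sum>j<n. B $$ (k, j) * cofactor B k j)"
    by (rule laplace_expansion_row[OF B k])
  also have "\<dots> = (\<Sum>j<n. if j = l then A $$ (k, l) * cofactor A k l else 0)"
    by (rule sum.cong) (use k l cof in \<open>auto simp: B_def\<close>)
  also have "\<dots> = A $$ (k, l) * cofactor A k l" using l by simp
  finally have "det B = A $$ (k, l) * cofactor A k l" .
  moreover have "det B = (\<Sum>\<pi>\<in>perms_at n k l. signof \<pi> * (\<Prod>i<n. B $$ (i, \<pi> i)))"
    unfolding det_eq_sum_perms[OF B]
  proof (rule sum.mono_neutral_right[OF finite_perms perms_at_subset], rule ballI)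
    fix \<pi> assume \<pi>: "\<pi> \<in> perms n - perms_at n k l"
    then have "\<pi> k \<noteq> l" "\<pi> k < n" using perms_less k by (auto simp: perms_at_def)
    then have "B $$ (k, \<pi> k) = 0" using k by (simp add: B_def)
    then have "(\<Prod>i<n. B $$ (i, \<pi> i)) = 0" using k by (intro prod_zero) auto
    then show "signof \<pi> * (\<Prod>i<n. B $$ (i, \<pi> i)) = 0" by simp
  qed
  moreover have "B $$ (i, \<pi> i) = A $$ (i, \<pi> i)" if "\<pi> \<in> perms_at n k l" "i < n" for \<pi> i
    using that perms_less[of \<pi> n i] by (auto simp: B_def perms_at_def)
  ultimately show ?thesis by simp
qed

lemma det_rank_one_correction:
  fixes A :: "'a::field mat"
  assumes A: "A \<in> carrier_mat n n"
    and d: "d = (\<Sum>k<n. \<Sum>l<n. u k * w l * cofactor A k l)" and nz: "d \<noteq> 0"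
  shows "det (mat n n (\<lambda>(i, j). A $$ (i, j) - u i * w j * det A / d)) = 0"
proof -
  let ?M = "mat n n (\<lambda>(i, j). A $$ (i, j) - u i * w j * det A / d)"
  define z where "z = adj_mat A *\<^sub>v vec n u"
  have adj: "adj_mat A \<in> carrier_mat n n" by (rule adj_mat[OF A])
  have z: "z \<in> carrier_vec n" using adj by (auto simp: z_def)
  \<comment> \<open>The adjugate is the transposed cofactor matrix, which is why \<open>u\<close>
    goes with the row index and \<open>w\<close> with the column index in \<open>d\<close>.\<close>
  have zl: "z $ l = (\<Sum>k<n. cofactor A k l * u k)" if "l < n" for l
    using that A adj by (simp add: z_def scalar_prod_def adj_mat_def atLeast0LessThan)
  have "A *\<^sub>v z = (A * adj_mat A) *\<^sub>v vec n u"
    unfolding z_def using A adj by (simp add: assoc_mult_mat_vec)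
  also have "\<dots> = det A \<cdot>\<^sub>v vec n u"
  proof (rule eq_vecI)
    fix i assume "i < dim_vec (det A \<cdot>\<^sub>v vec n u)"
    then have "i < n" by simp
    then have "((A * adj_mat A) *\<^sub>v vec n u) $ i = (\<Sum>j<n. det A * (if j = i then 1 else 0) * u j)"
      unfolding adj_mat(2)[OF A] by (simp add: scalar_prod_def atLeast0LessThan)
    also have "\<dots> = (\<Sum>j<n. if j = i then det A * u j else 0)"
      by (rule sum.cong) auto
    finally show "((A * adj_mat A) *\<^sub>v vec n u) $ i = (det A \<cdot>\<^sub>v vec n u) $ i"
      using \<open>i < n\<close> by simp
  qed (use A in simp)
  finally have "(A *\<^sub>v z) $ i = det A * u i" if "i < n" for i using that by simp
  then have Az: "(\<Sum>l<n. A $$ (i, l) * z $ l) = det A * u i" if "i < n" for i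
    using that A z by (simp add: scalar_prod_def atLeast0LessThan)
  have wz: "(\<Sum>l<n. w l * z $ l) = d"
    unfolding d by (subst sum.swap) (auto simp: zl sum_distrib_left algebra_simps intro!: sum.cong)
  \<comment> \<open>\<open>d\<close> is the pairing of \<open>w\<close> with \<open>z\<close>, so
    \<open>d \<noteq> 0\<close> both permits the division and makes the kernel vector
    non-zero.\<close>
  have "z \<noteq> 0\<^sub>v n" using wz nz by auto
  moreover have "?M *\<^sub>v z = 0\<^sub>v n"
  proof (rule eq_vecI)
    fix i assume "i < dim_vec (0\<^sub>v n :: 'a vec)"
    then have i: "i < n" by simp
    have "(?M *\<^sub>v z) $ i = (\<Sum>l<n. (A $$ (i, l) - u i * w l * det A / d) * z $ l)"
      using i z by (simp add: scalar_prod_def atLeast0LessThan)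
    also have "\<dots> = (\<Sum>l<n. A $$ (i, l) * z $ l) - u i * det A / d * (\<Sum>l<n. w l * z $ l)"
      by (simp add: sum_distrib_left sum_subtractf[symmetric] algebra_simps)
    also have "\<dots> = 0" unfolding Az[OF i] wz using nz by simp
    finally show "(?M *\<^sub>v z) $ i = 0\<^sub>v n $ i" using i by simp
  qed simp
  ultimately show ?thesis
    using det_0_iff_vec_prod_zero[of ?M n] z by auto
qed

section \<open>The parametrization in coordinates\<close>

definition laurent_var :: "'j \<Rightarrow> int \<Rightarrow> ('j, 'k::field) laurent" where
  "laurent_var i e = Poly_Mapping.single (Poly_Mapping.single i e) 1"

lemma laurent_var_in_laurent_polys: "i \<in> J \<Longrightarrow> laurent_var i e \<in> laurent_polys J"
  unfolding laurent_var_def by (rule laurent_polys_single) auto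

lemma laurent_eval_var: "laurent_eval (laurent_var i e) x = x i powi e"
  by (simp add: laurent_var_def laurent_eval_single monom_eval_single)

lemma laurent_var_mult: "laurent_var i a * laurent_var i b = laurent_var i (a + b)"
  by (simp add: laurent_var_def mult_single single_add)

lemma laurent_var_zero: "laurent_var i 0 = 1"
  by (simp add: laurent_var_def)

lemma laurent_val_var:
  assumes "nonarch_valuation v"
  shows "laurent_val v \<zeta> (laurent_var i e) = ereal (\<zeta> i * of_int e)"
  by (simp add: laurent_val_def laurent_var_def single_eq_0_iff trop_poly_single[OF assms]
      exponent_pairing_single val_one[OF assms])

text \<open>The parameters are the entries of \<open>A\<close>, \<open>u\<close> and \<open>w\<close>, stored in this order. The cofactor of
  \<open>A\<close> at \<open>(k, l)\<close> is written as the part of the Leibniz expansion using the entry \<open>(k, l)\<close>,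
  divided by that entry.\<close>

definition entry_idx :: "nat \<Rightarrow> nat \<times> nat \<Rightarrow> nat" where
  "entry_idx n kl = fst kl * n + snd kl"

definition row_idx :: "nat \<Rightarrow> nat \<Rightarrow> nat" where
  "row_idx n k = n * n + k"

definition col_idx :: "nat \<Rightarrow> nat \<Rightarrow> nat" where
  "col_idx n l = n * n + n + l"

definition num_params :: "nat \<Rightarrow> nat" where
  "num_params n = n * n + n + n"

definition denom_term :: "nat \<Rightarrow> nat \<times> nat \<Rightarrow> (nat, 'k::field) laurent" where
  "denom_term n kl = laurent_var (row_idx n (fst kl)) 1 * laurent_var (col_idx n (snd kl)) 1 *
     laurent_var (entry_idx n kl) (- 1) * perm_poly (entry_idx n) n (perms_at n (fst kl) (snd kl))"

definition denom :: "nat \<Rightarrow> (nat, 'k::field) laurent" where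
  "denom n = (\<Sum>kl\<in>{..<n} \<times> {..<n}. denom_term n kl)"

definition numer :: "nat \<Rightarrow> nat \<times> nat \<Rightarrow> (nat, 'k::field) laurent" where
  "numer n kl = laurent_var (entry_idx n kl) 1 * denom n -
     laurent_var (row_idx n (fst kl)) 1 * laurent_var (col_idx n (snd kl)) 1 *
     perm_poly (entry_idx n) n (perms n)"

lemma entry_idx_less: "k < n \<Longrightarrow> l < n \<Longrightarrow> entry_idx n (k, l) < n * n"
proof -
  assume "k < n" "l < n"
  then have "k * n + l < k * n + n" "k * n + n \<le> n * n"
    using mult_le_mono1[of "Suc k" n n] by auto
  then show ?thesis by (simp add: entry_idx_def)
qed

lemma entry_idx_div_mod: "l < n \<Longrightarrow> entry_idx n (k, l) div n = k \<and> entry_idx n (k, l) mod n = l"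
  by (simp add: entry_idx_def)

lemma inj_on_entry_idx: "inj_on (entry_idx n) ({..<n} \<times> {..<n})"
proof (rule inj_onI, clarify)
  fix k l k' l' assume "l < n" "l' < n" "entry_idx n (k, l) = entry_idx n (k', l')"
  then show "k = k' \<and> l = l'" by (metis entry_idx_div_mod)
qed

lemma param_idx_in:
  "kl \<in> {..<n} \<times> {..<n} \<Longrightarrow> entry_idx n kl \<in> {..<num_params n}"
  "k < n \<Longrightarrow> row_idx n k \<in> {..<num_params n}"
  "l < n \<Longrightarrow> col_idx n l \<in> {..<num_params n}"
  using entry_idx_less[of "fst kl" n "snd kl"]
  by (auto simp: row_idx_def col_idx_def num_params_def)

lemma entry_idx_image: "entry_idx n ` ({..<n} \<times> {..<n}) \<subseteq> {..<num_params n}"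
  using param_idx_in(1) by blast

text \<open>Polymorphic in the values, so that it yields points of the parameter torus as well as
  real weight vectors.\<close>

lemma exists_params:
  "\<exists>x \<in> {..<num_params n} \<rightarrow>\<^sub>E UNIV. (\<forall>kl\<in>{..<n} \<times> {..<n}. x (entry_idx n kl) = a kl) \<and>
     (\<forall>k<n. x (row_idx n k) = u k) \<and> (\<forall>l<n. x (col_idx n l) = w l)"
proof -
  define x where "x = (\<lambda>m\<in>{..<num_params n}. if m < n * n then a (m div n, m mod n)
    else if m < n * n + n then u (m - n * n) else w (m - (n * n + n)))"
  have "x (entry_idx n (k, l)) = a (k, l)" if "k < n" "l < n" for k l
    using that entry_idx_less[of k n l] entry_idx_div_mod[of l n k]
    by (simp add: x_def num_params_def)
  then show ?thesis
    by (intro bexI[of _ x]) (auto simp: x_def row_idx_def col_idx_def num_params_def)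
qed

lemma var_polys:
  assumes "k < n" "l < n"
  shows "laurent_var (entry_idx n (k, l)) e \<in> laurent_polys {..<num_params n}"
    "laurent_var (row_idx n k) e \<in> laurent_polys {..<num_params n}"
    "laurent_var (col_idx n l) e \<in> laurent_polys {..<num_params n}"
  using assms by (auto intro!: laurent_var_in_laurent_polys param_idx_in simp del: lessThan_iff)

lemma denom_term_in_laurent_polys:
  assumes "kl \<in> {..<n} \<times> {..<n}"
  shows "denom_term n kl \<in> laurent_polys {..<num_params n}"
  unfolding denom_term_def
  by (intro laurent_polys_mult laurent_var_in_laurent_polys param_idx_in
      perm_poly_in_laurent_polys entry_idx_image perms_at_subset) (use assms in auto)

lemma denom_in_laurent_polys: "denom n \<in> laurent_polys {..<num_params n}"
  unfolding denom_def by (intro laurent_polys_sum denom_term_in_laurent_polys)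

lemma numer_in_laurent_polys:
  assumes "kl \<in> {..<n} \<times> {..<n}"
  shows "numer n kl \<in> laurent_polys {..<num_params n}"
  unfolding numer_def
  by (intro laurent_polys_diff laurent_polys_mult laurent_var_in_laurent_polys param_idx_in
      perm_poly_in_laurent_polys entry_idx_image denom_in_laurent_polys) (use assms in auto)

context
  fixes n :: nat and x :: "nat \<Rightarrow> 'k::field" and A :: "'k mat"
  assumes x: "x \<in> torus {..<num_params n}"
    and A: "A = mat n n (\<lambda>kl. x (entry_idx n kl))"
begin

lemma laurent_eval_perm_poly_entries:
  assumes "S \<subseteq> perms n"
  shows "laurent_eval (perm_poly (entry_idx n) n S) x = (\<Sum>\<pi>\<in>S. signof \<pi> * (\<Prod>k<n. A $$ (k, \<pi> k)))"
  unfolding laurent_eval_perm_poly[OF x entry_idx_image assms]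
  by (rule sum.cong[OF refl], rule arg_cong2[of _ _ _ _ "(*)"], rule refl, rule prod.cong[OF refl])
     (use assms perms_less in \<open>auto simp: A\<close>)

text \<open>The partial Leibniz sum at (k, l) is the entry times its cofactor, and dividing by the
  entry is legitimate at a point of the torus.\<close>

lemma laurent_eval_denom:
  "laurent_eval (denom n) x =
     (\<Sum>k<n. \<Sum>l<n. x (row_idx n k) * x (col_idx n l) * cofactor A k l)"
proof -
  have "laurent_eval (denom_term n (k, l)) x = x (row_idx n k) * x (col_idx n l) * cofactor A k l"
    if kl: "k < n" "l < n" for k l
  proof -
    have "A \<in> carrier_mat n n" by (simp add: A)
    from sum_perms_at_eq_cofactor[OF this kl]
    have "laurent_eval (perm_poly (entry_idx n) n (perms_at n k l)) x = A $$ (k, l) * cofactor A k l"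
      by (simp add: laurent_eval_perm_poly_entries[OF perms_at_subset])
    moreover have "A $$ (k, l) = x (entry_idx n (k, l))" using kl by (simp add: A)
    moreover have "x (entry_idx n (k, l)) \<noteq> 0"
      using x param_idx_in(1)[of "(k, l)" n] kl by (auto simp: torus_def PiE_def Pi_def)
    ultimately show ?thesis
      unfolding denom_term_def
      by (simp add: var_polys[OF kl] laurent_eval_mult[OF x] laurent_polys_mult
          perm_poly_in_laurent_polys[OF entry_idx_image perms_at_subset]
          laurent_eval_var power_int_minus)
  qed
  then show ?thesis
    unfolding denom_def laurent_eval_sum sum.cartesian_product by (intro sum.cong) auto
qed

lemma laurent_eval_numer:
  assumes "k < n" "l < n"
  shows "laurent_eval (numer n (k, l)) x =
    x (entry_idx n (k, l)) * laurent_eval (denom n) x - x (row_idx n k) * x (col_idx n l) * det A"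
proof -
  have "A \<in> carrier_mat n n" by (simp add: A)
  from det_eq_sum_perms[OF this]
  have "laurent_eval (perm_poly (entry_idx n) n (perms n)) x = det A"
    by (simp add: laurent_eval_perm_poly_entries)
  then show ?thesis
    unfolding numer_def
    by (simp add: var_polys[OF assms] laurent_eval_diff laurent_eval_mult[OF x] laurent_polys_mult
        perm_poly_in_laurent_polys[OF entry_idx_image] denom_in_laurent_polys laurent_eval_var)
qed

lemma det_parametrized_matrix:
  assumes "laurent_eval (denom n) x \<noteq> 0"
  shows "det (mat n n (\<lambda>kl. laurent_eval (numer n kl) x / laurent_eval (denom n) x)) = 0"
proof -
  have "mat n n (\<lambda>kl. laurent_eval (numer n kl) x / laurent_eval (denom n) x)
      = mat n n (\<lambda>(i, j). A $$ (i, j) - x (row_idx n i) * x (col_idx n j) * det A / laurent_eval (denom n) x)"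
    by (rule eq_matI) (use assms in \<open>auto simp: laurent_eval_numer A diff_divide_distrib\<close>)
  then show ?thesis
    using det_rank_one_correction[OF _ laurent_eval_denom assms] by (simp add: A)
qed

end

section \<open>Valuations of the parametrization at the chosen weights\<close>

lemma perm_poly_Un:
  assumes "finite S" "finite T" "S \<inter> T = {}"
  shows "perm_poly a n (S \<union> T) = perm_poly a n S + perm_poly a n T"
  unfolding perm_poly_def by (rule sum.union_disjoint[OF assms])

text \<open>\<open>m\<close> is the tropical determinant at \<open>\<xi>\<close>, attained by
  \<open>\<pi>\<close> through the entry (i, j) and by \<open>\<sigma>\<close> avoiding it. The
  summand 1 in the bound on \<open>L\<close> leaves a gap of at least 1 between the leading terms
  and all terms containing \<open>u_k w_l\<close> for another (k, l).\<close>

context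
  fixes v :: "'k::field \<Rightarrow> ereal" and n i j :: nat and \<xi> :: "nat \<times> nat \<Rightarrow> real"
    and \<zeta> :: "nat \<Rightarrow> real" and L m :: real and \<pi> \<sigma> :: "nat \<Rightarrow> nat"
  assumes v: "nonarch_valuation v" and i: "i < n" and j: "j < n"
    and entry: "\<forall>kl\<in>{..<n} \<times> {..<n}. \<zeta> (entry_idx n kl) = \<xi> kl"
    and row: "\<forall>k<n. \<zeta> (row_idx n k) = (if k = i then 0 else L)"
    and col: "\<forall>l<n. \<zeta> (col_idx n l) = (if l = j then 0 else L)"
    and L: "\<forall>kl\<in>{..<n} \<times> {..<n}. 1 + \<xi> kl - \<xi> (i, j) \<le> L"
    and min: "\<forall>\<tau>\<in>perms n. m \<le> perm_weight \<xi> n \<tau>"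
    and \<pi>: "\<pi> \<in> perms_at n i j" "perm_weight \<xi> n \<pi> = m"
    and \<sigma>: "\<sigma> \<in> perms n - perms_at n i j" "perm_weight \<xi> n \<sigma> = m"
begin

lemma perm_weight_entry: "\<tau> \<in> perms n \<Longrightarrow> perm_weight (\<zeta> \<circ> entry_idx n) n \<tau> = perm_weight \<xi> n \<tau>"
  unfolding perm_weight_def by (rule sum.cong) (use entry perms_less in auto)

lemma laurent_val_perms_ge:
  "S \<subseteq> perms n \<Longrightarrow> ereal m \<le> laurent_val v \<zeta> (perm_poly (entry_idx n) n S)"
  using min perm_weight_entry
  by (intro laurent_val_perm_poly_ge[OF v inj_on_entry_idx]) auto

lemma laurent_val_perms:
  assumes S: "S \<subseteq> perms n" and "\<pi> \<in> S \<or> \<sigma> \<in> S"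
  shows "laurent_val v \<zeta> (perm_poly (entry_idx n) n S) = ereal m"
proof -
  obtain \<tau> where \<tau>: "\<tau> \<in> S" "perm_weight \<xi> n \<tau> = m" using assms(2) \<pi>(2) \<sigma>(2) by blast
  show ?thesis
  proof (rule laurent_val_perm_poly[OF v inj_on_entry_idx S \<tau>(1)])
    show "perm_weight (\<zeta> \<circ> entry_idx n) n \<tau> = m" using \<tau> S perm_weight_entry by auto
    show "m \<le> perm_weight (\<zeta> \<circ> entry_idx n) n \<rho>" if "\<rho> \<in> S" for \<rho>
      using that S min perm_weight_entry by auto
  qed
qed

text \<open>This is the bound on \<open>L\<close> at (i, j) itself; it ensures that
  \<open>L + L\<close>, the weight of \<open>u_k w_l\<close> off row \<open>i\<close> and column
  \<open>j\<close>, is at least \<open>L\<close>.\<close>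

lemma L_ge: "1 \<le> L"
  using bspec[OF L, of "(i, j)"] i j by simp

lemma laurent_val_row_col_ge:
  assumes "k < n" "l < n" "(k, l) \<noteq> (i, j)"
  shows "L \<le> \<zeta> (row_idx n k) + \<zeta> (col_idx n l)"
  using assms row col L_ge by auto

lemma laurent_val_denom_term:
  assumes "k < n" "l < n"
  shows "laurent_val v \<zeta> (denom_term n (k, l)) =
    ereal (\<zeta> (row_idx n k) + \<zeta> (col_idx n l) - \<xi> (k, l)) +
    laurent_val v \<zeta> (perm_poly (entry_idx n) n (perms_at n k l))"
  using assms entry by (simp add: denom_term_def laurent_val_mult[OF v] laurent_val_var[OF v])

text \<open>The variables of row \<open>i\<close> and column \<open>j\<close> weigh 0, the inverted
  entry contributes \<open>- \<xi> (i, j)\<close>, and \<open>\<pi>\<close> gives the partial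
  expansion the weight \<open>m\<close>.\<close>

lemma laurent_val_denom_term_main: "laurent_val v \<zeta> (denom_term n (i, j)) = ereal (m - \<xi> (i, j))"
  using i j row col laurent_val_perms[OF perms_at_subset[of n i j]] \<pi>
  by (simp add: laurent_val_denom_term)

lemma laurent_val_denom_term_other:
  assumes kl: "k < n" "l < n" "(k, l) \<noteq> (i, j)"
  shows "ereal (m - \<xi> (i, j) + 1) \<le> laurent_val v \<zeta> (denom_term n (k, l))"
proof -
  have "1 + \<xi> (k, l) - \<xi> (i, j) \<le> L" using L kl by auto
  then have "ereal (m - \<xi> (i, j) + 1) \<le>
      ereal (\<zeta> (row_idx n k) + \<zeta> (col_idx n l) - \<xi> (k, l)) + ereal m"
    using laurent_val_row_col_ge[OF kl] by simp
  also have "\<dots> \<le> laurent_val v \<zeta> (denom_term n (k, l))"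
    unfolding laurent_val_denom_term[OF kl(1,2)]
    by (intro add_left_mono laurent_val_perms_ge perms_at_subset)
  finally show ?thesis .
qed

lemma laurent_val_denom: "laurent_val v \<zeta> (denom n) = ereal (m - \<xi> (i, j))"
proof -
  have "laurent_val v \<zeta> (denom n) = laurent_val v \<zeta> (denom_term n (i, j))"
    unfolding denom_def
  proof (rule laurent_val_sum_dominant[OF v])
    show "denom_term n (i, j) \<noteq> (0 :: (nat, 'k) laurent)"
      using laurent_val_denom_term_main by (auto simp: laurent_val_eq_ereal_iff)
    fix kl assume kl: "kl \<in> {..<n} \<times> {..<n} - {(i, j)}"
    then have "ereal (m - \<xi> (i, j) + 1) \<le> laurent_val v \<zeta> (denom_term n kl)"
      using laurent_val_denom_term_other by (cases kl) auto
    then show "laurent_val v \<zeta> (denom_term n (i, j)) < laurent_val v \<zeta> (denom_term n kl)"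
      unfolding laurent_val_denom_term_main by (rule less_le_trans[rotated]) simp
  qed (use i j in auto)
  then show ?thesis by (simp add: laurent_val_denom_term_main)
qed

text \<open>The subtracted term weighs at least \<open>L + m\<close>, which exceeds the weight of
  the first term by at least 1, so the correction is tropically invisible here.\<close>

lemma laurent_val_numer_other:
  assumes kl: "k < n" "l < n" "(k, l) \<noteq> (i, j)"
  shows "laurent_val v \<zeta> (numer n (k, l)) = ereal (\<xi> (k, l) + (m - \<xi> (i, j)))"
proof -
  let ?a = "laurent_var (entry_idx n (k, l)) 1 * denom n :: (nat, 'k) laurent"
  let ?b = "laurent_var (row_idx n k) 1 * laurent_var (col_idx n l) 1 *
    perm_poly (entry_idx n) n (perms n) :: (nat, 'k) laurent"
  have a: "laurent_val v \<zeta> ?a = ereal (\<xi> (k, l) + (m - \<xi> (i, j)))"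
    using kl entry by (simp add: laurent_val_mult[OF v] laurent_val_var[OF v] laurent_val_denom)
  have b: "laurent_val v \<zeta> ?b = ereal (\<zeta> (row_idx n k) + \<zeta> (col_idx n l) + m)"
    using laurent_val_perms[OF order_refl] \<sigma>(1)
    by (simp add: laurent_val_mult[OF v] laurent_val_var[OF v])
  have "1 + \<xi> (k, l) - \<xi> (i, j) \<le> L" using L kl by auto
  then have "laurent_val v \<zeta> ?a < laurent_val v \<zeta> (- ?b)"
    unfolding laurent_val_uminus[OF v] a b using laurent_val_row_col_ge[OF kl] by simp
  from laurent_val_add_dominant[OF v this] show ?thesis
    by (simp add: numer_def a)
qed

text \<open>The two terms of \<open>numer\<close> tie, so the cancellation is carried out in the
  ring before any valuation is taken.\<close>

lemma laurent_val_numer_main: "laurent_val v \<zeta> (numer n (i, j)) = ereal m"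
proof -
  let ?I = "{..<n} \<times> {..<n}" and ?P = "perm_poly (entry_idx n) n :: _ \<Rightarrow> (nat, 'k) laurent"
  let ?u = "laurent_var (row_idx n i) 1 * laurent_var (col_idx n j) 1 :: (nat, 'k) laurent"
    and ?x = "\<lambda>e. laurent_var (entry_idx n (i, j)) e :: (nat, 'k) laurent"
  \<comment> \<open>\<open>R\<close> comes from the summands of \<open>denom\<close> other than (i,
    j) and weighs at least \<open>m + 1\<close>. \<open>F\<close> is the part of
    \<open>u_i w_j det A\<close> avoiding the entry (i, j) and weighs \<open>m\<close> because of
    \<open>\<sigma>\<close>.\<close>
  define R where "R = ?x 1 * (\<Sum>kl\<in>?I - {(i, j)}. denom_term n kl)"
  define F where "F = ?u * ?P (perms n - perms_at n i j)"
  have fin: "finite (perms_at n i j)" by (rule finite_subset[OF perms_at_subset finite_perms])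
  have "?P (perms n) = ?P (perms_at n i j \<union> (perms n - perms_at n i j))"
    using perms_at_subset[of n i j] by (simp add: Un_absorb1)
  also have "\<dots> = ?P (perms_at n i j) + ?P (perms n - perms_at n i j)"
    by (rule perm_poly_Un) (use fin finite_perms in auto)
  finally have split: "?P (perms n) = ?P (perms_at n i j) + ?P (perms n - perms_at n i j)" .
  have "denom n = denom_term n (i, j) + (\<Sum>kl\<in>?I - {(i, j)}. denom_term n kl :: (nat, 'k) laurent)"
    unfolding denom_def by (rule sum.remove) (use i j in auto)
  then have "?x 1 * denom n = ?x 1 * denom_term n (i, j) + R"
    by (simp add: R_def distrib_left)
  \<comment> \<open>The entry cancels its inverse in \<open>denom_term\<close>, leaving exactly the
    part of \<open>u_i w_j det A\<close> that uses (i, j).\<close>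
  also have "?x 1 * denom_term n (i, j) = (?x 1 * ?x (- 1)) * (?u * ?P (perms_at n i j))"
    by (simp add: denom_term_def mult_ac)
  also have "?x 1 * ?x (- 1) = 1"
    by (simp add: laurent_var_mult laurent_var_zero)
  finally have "numer n (i, j) = - F + R"
    by (simp add: numer_def F_def split distrib_left)
  moreover have F: "laurent_val v \<zeta> (- F) = ereal m"
    unfolding laurent_val_uminus[OF v] using i j row col laurent_val_perms[of "perms n - perms_at n i j"] \<sigma>(1)
    by (simp add: F_def laurent_val_mult[OF v] laurent_val_var[OF v])
  have "ereal (m - \<xi> (i, j) + 1) \<le> laurent_val v \<zeta> (\<Sum>kl\<in>?I - {(i, j)}. denom_term n kl)"
  proof (rule laurent_val_sum_ge[OF v])
    fix kl assume "kl \<in> ?I - {(i, j)}"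
    then show "ereal (m - \<xi> (i, j) + 1) \<le> laurent_val v \<zeta> (denom_term n kl)"
      using laurent_val_denom_term_other by (cases kl) auto
  qed
  then have "ereal (\<xi> (i, j)) + ereal (m - \<xi> (i, j) + 1) \<le> laurent_val v \<zeta> R"
    unfolding R_def laurent_val_mult[OF v] laurent_val_var[OF v]
    using entry i j by (simp add: add_left_mono del: plus_ereal.simps)
  then have "laurent_val v \<zeta> (- F) < laurent_val v \<zeta> R"
    unfolding F by (rule less_le_trans[rotated]) simp
  from laurent_val_add_dominant[OF v this] have "laurent_val v \<zeta> (- F + R) = ereal m"
    by (simp add: F)
  ultimately show ?thesis by simp
qed

lemma trop_poly_numer_denom:
  assumes "kl \<in> {..<n} \<times> {..<n}"
  shows "numer n kl \<noteq> (0 :: (nat, 'k) laurent)" "denom n \<noteq> (0 :: (nat, 'k) laurent)"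
    "trop_poly v (numer n kl) \<zeta> - trop_poly v (denom n) \<zeta> = \<xi> kl"
proof -
  \<comment> \<open>At (i, j) the right-hand side is \<open>m\<close>, so one formula serves both
    cases.\<close>
  have "laurent_val v \<zeta> (numer n kl) = ereal (\<xi> kl + (m - \<xi> (i, j)))"
    using laurent_val_numer_main laurent_val_numer_other assms
    by (cases kl; cases "kl = (i, j)") auto
  then show "numer n kl \<noteq> (0 :: (nat, 'k) laurent)" "denom n \<noteq> (0 :: (nat, 'k) laurent)"
    "trop_poly v (numer n kl) \<zeta> - trop_poly v (denom n) \<zeta> = \<xi> kl"
    using laurent_val_denom by (simp_all add: laurent_val_eq_ereal_iff)
qed

end

section \<open>Points of the parameter torus and the equation of the singular matrices\<close>

lemma param_idx_cases:
  assumes "m < num_params n"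
  obtains (entry) kl where "kl \<in> {..<n} \<times> {..<n}" "m = entry_idx n kl"
    | (row) k where "k < n" "m = row_idx n k" | (col) l where "l < n" "m = col_idx n l"
proof -
  consider "m < n * n" | "n * n \<le> m" "m < n * n + n" | "n * n + n \<le> m" by linarith
  then show thesis
  proof cases
    case 1
    then have "n > 0" by (cases n) auto
    with 1 have "(m div n, m mod n) \<in> {..<n} \<times> {..<n}" "m = entry_idx n (m div n, m mod n)"
      by (auto simp: entry_idx_def less_mult_imp_div_less)
    then show thesis by (rule entry)
  next
    case 2
    then show thesis by (intro row[of "m - n * n"]) (auto simp: row_idx_def)
  next
    case 3
    then show thesis using assms
      by (intro col[of "m - (n * n + n)"]) (auto simp: col_idx_def num_params_def)
  qed
qed

lemma torus_paramsI:
  assumes "x \<in> {..<num_params n} \<rightarrow>\<^sub>E UNIV" "\<And>kl. kl \<in> {..<n} \<times> {..<n} \<Longrightarrow> x (entry_idx n kl) \<noteq> 0"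
    "\<And>k. k < n \<Longrightarrow> x (row_idx n k) \<noteq> 0" "\<And>l. l < n \<Longrightarrow> x (col_idx n l) \<noteq> 0"
  shows "x \<in> torus {..<num_params n}"
  unfolding torus_def
proof (rule PiE_I)
  fix m assume "m \<in> {..<num_params n}"
  then have "m < num_params n" by simp
  then show "x m \<in> - {0}" by (cases rule: param_idx_cases) (use assms in auto)
qed (use assms(1) in auto)

lemma laurent_eval_det:
  assumes "M \<in> torus ({..<n} \<times> {..<n})"
  shows "laurent_eval (perm_poly id n (perms n)) M = det (mat n n M)"
proof -
  have "laurent_eval (perm_poly id n (perms n)) M
      = (\<Sum>\<pi>\<in>perms n. signof \<pi> * (\<Prod>k<n. mat n n M $$ (k, \<pi> k)))"
    unfolding laurent_eval_perm_poly[OF assms, of id n, simplified, OF order_refl]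
    by (intro sum.cong refl arg_cong2[of _ _ _ _ "(*)"] prod.cong) (use perms_less in auto)
  then show ?thesis using det_eq_sum_perms[of "mat n n M" n] by simp
qed

lemma det_poly_in_laurent_polys: "perm_poly id n (perms n) \<in> laurent_polys ({..<n} \<times> {..<n})"
  by (rule perm_poly_in_laurent_polys) auto

lemma singular_matrices_eq_zero_locus:
  "singular_matrices n = zero_locus ({..<n} \<times> {..<n}) {perm_poly id n (perms n)}"
  by (auto simp: singular_matrices_def zero_locus_def laurent_eval_det)

subsection \<open>Density of the image\<close>

text \<open>If the form vanishes at the all-ones vector, changing coordinate \<open>l0\<close> to
  some \<open>t\<close> other than 0 and 1 changes its value by
  \<open>(t - 1) * c l0\<close>.\<close>

lemma exists_linear_form_neq_zero:
  fixes c :: "nat \<Rightarrow> 'k::field"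
  assumes inf: "infinite (UNIV :: 'k set)" and l0: "l0 < n" "c l0 \<noteq> 0"
  shows "\<exists>w. (\<forall>l. w l \<noteq> 0) \<and> (\<Sum>l<n. w l * c l) \<noteq> 0"
proof (cases "(\<Sum>l<n. c l) = 0")
  case True
  obtain t :: 'k where t: "t \<notin> {0, 1}"
    using inf ex_new_if_finite[of "{0, 1 :: 'k}"] by auto
  have "(\<Sum>l<n. (if l = l0 then t else 1) * c l) = (\<Sum>l<n. c l + (if l = l0 then (t - 1) * c l else 0))"
    by (rule sum.cong) (auto simp: algebra_simps)
  also have "\<dots> = (t - 1) * c l0"
    using True l0 by (simp add: sum.distrib)
  finally show ?thesis using t l0 by (intro exI[of _ "\<lambda>l. if l = l0 then t else 1"]) auto
next
  case False
  then show ?thesis by (intro exI[of _ "\<lambda>_. 1"]) simp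
qed

definition param_map :: "nat \<Rightarrow> nat \<times> nat \<Rightarrow> (nat, 'k::field) laurent fract" where
  "param_map n kl = Fract (numer n kl) (denom n)"

text \<open>With \<open>A = M\<close> the correction is zero, so the only issue is to make
  \<open>denom\<close> non-zero. It is bilinear in \<open>u\<close> and \<open>w\<close> with the
  cofactors as coefficients: \<open>w\<close> is chosen for row \<open>k0\<close>, then
  \<open>u\<close> for the resulting non-zero vector.\<close>

lemma mem_image_param_map:
  fixes M :: "nat \<times> nat \<Rightarrow> 'k::field"
  assumes inf: "infinite (UNIV :: 'k set)" and M: "M \<in> singular_matrices n"
    and cof: "k0 < n" "l0 < n" "cofactor (mat n n M) k0 l0 \<noteq> 0"
  shows "M \<in> ratmap_eval {..<num_params n} ({..<n} \<times> {..<n}) (param_map n) `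
    ratmap_domain {..<num_params n} ({..<n} \<times> {..<n}) (param_map n)"
proof -
  let ?J = "{..<num_params n}" and ?I = "{..<n} \<times> {..<n}"
  have MI: "M \<in> torus ?I" and det: "det (mat n n M) = 0"
    using M by (auto simp: singular_matrices_def)
  have "\<exists>w. (\<forall>l. w l \<noteq> 0) \<and> (\<Sum>l<n. w l * cofactor (mat n n M) k0 l) \<noteq> 0"
    by (rule exists_linear_form_neq_zero[OF inf cof(2)]) (rule cof(3))
  then obtain w where w: "\<forall>l. w l \<noteq> 0" "(\<Sum>l<n. w l * cofactor (mat n n M) k0 l) \<noteq> 0" by auto
  have "\<exists>u. (\<forall>k. u k \<noteq> 0) \<and> (\<Sum>k<n. u k * (\<Sum>l<n. w l * cofactor (mat n n M) k l)) \<noteq> 0"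
    by (rule exists_linear_form_neq_zero[OF inf cof(1)]) (rule w(2))
  then obtain u where u: "\<forall>k. u k \<noteq> 0"
    "(\<Sum>k<n. u k * (\<Sum>l<n. w l * cofactor (mat n n M) k l)) \<noteq> 0"
    by auto
  obtain x where xJ: "x \<in> ?J \<rightarrow>\<^sub>E UNIV" and entry: "\<forall>kl\<in>?I. x (entry_idx n kl) = M kl"
    and row: "\<forall>k<n. x (row_idx n k) = u k" and col: "\<forall>l<n. x (col_idx n l) = w l"
    using exists_params[of n M u w] by blast
  have Mnz: "M kl \<noteq> 0" if "kl \<in> ?I" for kl using MI that by (auto simp: torus_def PiE_def Pi_def)
  have x: "x \<in> torus ?J"
    by (rule torus_paramsI[OF xJ]) (use entry row col u w Mnz in auto)
  have A: "mat n n M = mat n n (\<lambda>kl. x (entry_idx n kl))"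
    by (rule cong_mat) (use entry in auto)
  have denom: "laurent_eval (denom n) x \<noteq> 0"
    unfolding laurent_eval_denom[OF x A] using u row col
    by (simp add: sum_distrib_left mult.assoc)
  have numer: "laurent_eval (numer n kl) x = M kl * laurent_eval (denom n) x" if "kl \<in> ?I" for kl
    using laurent_eval_numer[OF x A, of "fst kl" "snd kl"] that entry det by auto
  have "(denom n :: (nat, 'k) laurent) \<noteq> 0" using denom by auto
  then have frac: "is_fraction ?J (param_map n kl) (numer n kl) (denom n :: (nat, 'k) laurent)" if "kl \<in> ?I" for kl
    using that by (simp add: is_fraction_def param_map_def numer_in_laurent_polys denom_in_laurent_polys)
  have val: "ratfun_eval ?J (param_map n kl) x = M kl" if "kl \<in> ?I" for kl
    using ratfun_eval_eq[OF x frac[OF that] denom] numer[OF that] denom by simp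
  have "x \<in> ratmap_domain ?J ?I (param_map n)"
    unfolding ratmap_domain_def
  proof (intro CollectI conjI ballI x)
    fix kl assume kl: "kl \<in> ?I"
    show "regular_at ?J (param_map n kl) x" unfolding regular_at_def using frac[OF kl] denom by blast
    show "ratfun_eval ?J (param_map n kl) x \<noteq> 0" unfolding val[OF kl] by (rule Mnz[OF kl])
  qed
  moreover have "ratmap_eval ?J ?I (param_map n) x = M"
  proof
    fix kl show "ratmap_eval ?J ?I (param_map n) x kl = M kl"
      using val[of kl] MI PiE_arb[of M ?I "\<lambda>_. - {0}" kl]
      by (cases "kl \<in> ?I") (auto simp: ratmap_eval_def torus_def simp del: mem_Sigma_iff)
  qed
  ultimately show ?thesis by (metis image_eqI)
qed

text \<open>Multiplying by powers of the coordinates turns the restriction of \<open>f\<close> to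
  the curve into a polynomial \<open>Q\<close> in one variable with infinitely many roots.\<close>

lemma laurent_eval_eq_zero_on_curve:
  fixes f :: "('i, 'k::field) laurent" and g :: "'i \<Rightarrow> 'k poly"
  assumes I: "finite I" and f: "f \<in> laurent_polys I"
    and T: "infinite T" "\<And>t. t \<in> T \<Longrightarrow> laurent_eval f (\<lambda>i\<in>I. poly (g i) t) = 0"
      "\<And>t i. t \<in> T \<Longrightarrow> i \<in> I \<Longrightarrow> poly (g i) t \<noteq> 0"
    and s: "\<And>i. i \<in> I \<Longrightarrow> poly (g i) s \<noteq> 0"
  shows "laurent_eval f (\<lambda>i\<in>I. poly (g i) s) = 0"
proof -
  obtain k where k: "\<forall>\<alpha>\<in>Poly_Mapping.keys f. \<forall>i\<in>I. \<bar>Poly_Mapping.lookup \<alpha> i\<bar> < int k"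
    using ex_exponent_bound[OF I] by blast
  define Q where "Q = (\<Sum>\<alpha>\<in>Poly_Mapping.keys f. [:Poly_Mapping.lookup f \<alpha>:] *
    (\<Prod>i\<in>I. g i ^ nat (int k + Poly_Mapping.lookup \<alpha> i)))"
  have Q: "poly Q t = laurent_eval f (\<lambda>i\<in>I. poly (g i) t) * (\<Prod>i\<in>I. poly (g i) t ^ k)"
    if "\<And>i. i \<in> I \<Longrightarrow> poly (g i) t \<noteq> 0" for t
    using clear_denominators_field[OF f I k, of "\<lambda>i. poly (g i) t" "\<lambda>_. 1"] that
    by (simp add: Q_def poly_sum poly_prod)
  have "T \<subseteq> {t. poly Q t = 0}"
    using Q T by auto
  then have "Q = 0" using T(1) poly_roots_finite finite_subset by blast
  then show ?thesis using Q[of s] s I by simp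
qed

lemma poly_cofactor:
  "poly (cofactor B i j) t = cofactor (map_mat (\<lambda>q. poly q t) B) i j"
  for B :: "'k::field poly mat"
proof -
  interpret comm_ring_hom "\<lambda>q :: 'k poly. poly q t" by unfold_locales auto
  have "mat_delete (map_mat (\<lambda>q. poly q t) B) i j = map_mat (\<lambda>q. poly q t) (mat_delete B i j)"
    by (rule eq_matI) (auto simp: mat_delete_def)
  then show ?thesis by (simp add: cofactor_def hom_det)
qed

text \<open>Deforming a singular matrix within the matrices that annihilate a vector of its kernel
  reaches corank one.\<close>

lemma laurent_eval_singular_matrix:
  fixes f :: "(nat \<times> nat, 'k::field) laurent"
  assumes inf: "infinite (UNIV :: 'k set)" and f: "f \<in> laurent_polys ({..<n} \<times> {..<n})"
    and zero: "\<And>M k l. M \<in> singular_matrices n \<Longrightarrow> k < n \<Longrightarrow> l < n \<Longrightarrow>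
      cofactor (mat n n M) k l \<noteq> 0 \<Longrightarrow> laurent_eval f M = 0"
    and M: "M \<in> singular_matrices n"
  shows "laurent_eval f M = 0"
proof -
  let ?I = "{..<n} \<times> {..<n}"
  have MI: "M \<in> torus ?I" and det: "det (mat n n M) = 0"
    using M by (auto simp: singular_matrices_def)
  obtain x where x: "x \<in> carrier_vec n" "x \<noteq> 0\<^sub>v n" and Mx: "mat n n M *\<^sub>v x = 0\<^sub>v n"
    using det_0_iff_vec_prod_zero[of "mat n n M" n] det by auto
  have "\<exists>j<n. x $ j \<noteq> 0"
  proof (rule ccontr)
    assume "\<not> ?thesis"
    then have "x = 0\<^sub>v n" using x(1) by (intro eq_vecI) auto
    then show False using x(2) by simp
  qed
  then obtain j where j: "j < n" "x $ j \<noteq> 0" by blast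
  \<comment> \<open>The identity matrix with column \<open>j\<close> replaced so that it annihilates
    \<open>x\<close>. Row \<open>j\<close> becomes zero and the minor at (j, j) is still an identity
    matrix. \<open>N\<close> need not lie in the torus; it only gives the direction of the
    deformation.\<close>
  define N where "N kl = (if snd kl = j then if fst kl = j then 0 else - x $ fst kl / x $ j
    else if fst kl = snd kl then 1 else 0)" for kl
  \<comment> \<open>The line through \<open>M\<close> at parameter 0 and \<open>N\<close> at
    parameter 1; all its points annihilate \<open>x\<close>.\<close>
  define g where "g kl = [:M kl, N kl - M kl:]" for kl
  define G where "G t = (\<lambda>kl\<in>?I. poly (g kl) t)" for t
  define c where "c = cofactor (mat n n g) j j"
  have Mrow: "(\<Sum>l<n. M (k, l) * x $ l) = 0" if "k < n" for k
    using arg_cong[OF Mx, of "\<lambda>y. y $ k"] that x(1) by (simp add: scalar_prod_def atLeast0LessThan)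
  have Nrow: "(\<Sum>l<n. N (k, l) * x $ l) = 0" if k: "k < n" for k
  proof (cases "k = j")
    case True
    then show ?thesis by (intro sum.neutral) (auto simp: N_def)
  next
    case False
    have "(\<Sum>l<n. N (k, l) * x $ l) = (\<Sum>l<n. (if l = j then - x $ k else 0) + (if l = k then x $ k else 0))"
      by (rule sum.cong) (use False j in \<open>auto simp: N_def\<close>)
    also have "\<dots> = 0" using k j by (simp add: sum.distrib)
    finally show ?thesis .
  qed
  have detG: "det (mat n n (G t)) = 0" for t
  proof -
    have "mat n n (G t) *\<^sub>v x = 0\<^sub>v n"
    proof (rule eq_vecI)
      fix k assume "k < dim_vec (0\<^sub>v n :: 'k vec)"
      then have k: "k < n" by simp
      have "(mat n n (G t) *\<^sub>v x) $ k = (\<Sum>l<n. (M (k, l) + t * (N (k, l) - M (k, l))) * x $ l)"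
        using k x(1) by (simp add: scalar_prod_def atLeast0LessThan G_def g_def)
      also have "\<dots> = (1 - t) * (\<Sum>l<n. M (k, l) * x $ l) + t * (\<Sum>l<n. N (k, l) * x $ l)"
        by (simp add: sum_distrib_left sum.distrib[symmetric] algebra_simps)
      finally show "(mat n n (G t) *\<^sub>v x) $ k = 0\<^sub>v n $ k" using Mrow Nrow k by simp
    qed simp
    then show ?thesis using det_0_iff_vec_prod_zero[of "mat n n (G t)" n] x by auto
  qed
  have cG: "poly c t = cofactor (mat n n (G t)) j j" for t
  proof -
    have "map_mat (\<lambda>q. poly q t) (mat n n g) = mat n n (G t)"
      by (rule eq_matI) (auto simp: G_def)
    then show ?thesis by (simp add: c_def poly_cofactor)
  qed
  have "mat_delete (mat n n (G 1)) j j = 1\<^sub>m (n - 1)"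
    by (rule eq_matI) (use j in \<open>auto simp: mat_delete_def G_def g_def N_def\<close>)
  then have "poly c 1 \<noteq> 0" unfolding cG by (simp add: cofactor_def)
  then have "c \<noteq> 0" by auto
  moreover have gM: "poly (g kl) 0 = M kl" for kl by (simp add: g_def)
  have Mnz: "M kl \<noteq> 0" if "kl \<in> ?I" for kl using MI that by (auto simp: torus_def PiE_def Pi_def)
  then have "g kl \<noteq> 0" if "kl \<in> ?I" for kl using that gM[of kl] by force
  ultimately have "c * (\<Prod>kl\<in>?I. g kl) \<noteq> 0" by simp
  then have fin: "finite {t. poly (c * (\<Prod>kl\<in>?I. g kl)) t = 0}" by (rule poly_roots_finite)
  \<comment> \<open>The good parameters: every entry is non-zero, so the matrix lies in the torus,
    and the cofactor at (j, j) is non-zero.\<close>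
  define T where "T = - {t. poly (c * (\<Prod>kl\<in>?I. g kl)) t = 0}"
  have T: "infinite T"
    using fin inf by (simp add: T_def Compl_eq_Diff_UNIV)
  have gT: "poly (g kl) t \<noteq> 0" if "t \<in> T" "kl \<in> ?I" for t kl
    using that by (auto simp: T_def poly_prod)
  have "laurent_eval f (\<lambda>kl\<in>?I. poly (g kl) 0) = 0"
  proof (rule laurent_eval_eq_zero_on_curve[OF _ f T])
    fix t assume t: "t \<in> T"
    have "G t \<in> torus ?I" unfolding torus_def G_def using gT[OF t] by (intro restrict_PiE_iff[THEN iffD2]) simp
    then have "G t \<in> singular_matrices n" using detG by (simp add: singular_matrices_def)
    moreover have "cofactor (mat n n (G t)) j j \<noteq> 0"
      using t by (simp add: T_def flip: cG)
    ultimately show "laurent_eval f (\<lambda>kl\<in>?I. poly (g kl) t) = 0"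
      using zero[of "G t" j j] j(1) by (simp add: G_def)
  qed (use gT Mnz gM in auto)
  moreover have "(\<lambda>kl\<in>?I. poly (g kl) 0) = M"
    unfolding gM using MI by (auto simp: torus_def PiE_def extensional_restrict)
  ultimately show ?thesis by simp
qed

section \<open>Dominance and the image of the tropicalization for matrices of size at least
  two\<close>

context
  fixes v :: "'k::field \<Rightarrow> ereal" and n :: nat
  assumes v: "nonarch_valuation v" and n: "n \<ge> 2"
begin

text \<open>The tropical computation at \<open>\<xi> = 0\<close> certifies this, because it gives
  finite valuations. The identity uses the entry (0, 0), and the transposition of 0 and 1, available
  since \<open>n \<ge> 2\<close>, avoids it; \<open>L = 1\<close> meets the gap condition.\<close>

lemma numer_denom_neq_zero:
  assumes "kl \<in> {..<n} \<times> {..<n}"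
  shows "numer n kl \<noteq> (0 :: (nat, 'k) laurent)" "denom n \<noteq> (0 :: (nat, 'k) laurent)"
proof -
  obtain \<zeta> :: "nat \<Rightarrow> real" where \<zeta>: "\<forall>kl\<in>{..<n} \<times> {..<n}. \<zeta> (entry_idx n kl) = 0"
    "\<forall>k<n. \<zeta> (row_idx n k) = (if k = 0 then 0 else 1)"
    "\<forall>l<n. \<zeta> (col_idx n l) = (if l = 0 then 0 else 1)"
    using exists_params[of n "\<lambda>_. 0 :: real" "\<lambda>k. if k = 0 then 0 else 1" "\<lambda>k. if k = 0 then 0 else 1"]
    by blast
  have "transpose 0 1 permutes {0..<n}" using n by (intro permutes_swap_id) auto
  then have "transpose 0 1 \<in> perms n - perms_at n 0 0" "id \<in> perms_at n 0 0"
    by (auto simp: perms_at_def permutes_id)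
  then show "numer n kl \<noteq> (0 :: (nat, 'k) laurent)" "denom n \<noteq> (0 :: (nat, 'k) laurent)"
    using trop_poly_numer_denom(1,2)[OF v, where i = 0 and j = 0 and \<xi> = "\<lambda>_. 0" and L = 1 and m = 0
        and \<sigma> = "transpose 0 1" and \<pi> = id, OF _ _ \<zeta> _ _ _ _ _ _ assms] n
    by (auto simp: perm_weight_def)
qed

lemma is_fraction_param_map:
  assumes "kl \<in> {..<n} \<times> {..<n}"
  shows "is_fraction {..<num_params n} (param_map n kl) (numer n kl) (denom n :: (nat, 'k) laurent)"
  using assms numer_denom_neq_zero[OF assms]
  by (simp add: is_fraction_def param_map_def numer_in_laurent_polys denom_in_laurent_polys)

lemma rational_map_param_map:
  "rational_map {..<num_params n} ({..<n} \<times> {..<n}) (param_map n :: _ \<Rightarrow> (nat, 'k) laurent fract)"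
  unfolding rational_map_def
proof
  fix kl assume kl: "kl \<in> {..<n} \<times> {..<n}"
  have "param_map n kl \<noteq> (0 :: (nat, 'k) laurent fract)"
    using numer_denom_neq_zero[OF kl] by (simp add: param_map_def Zero_fract_def eq_fract)
  then show "param_map n kl \<in> rational_functions {..<num_params n} - {0 :: (nat, 'k) laurent fract}"
    using is_fraction_param_map[OF kl] by (auto simp: rational_functions_def)
qed

text \<open>The determinant vanishes on the image, which bounds the closure from above; for the
  other inclusion, a Laurent polynomial vanishing on the image vanishes at the corank-one matrices
  and hence at all singular ones.\<close>

lemma dominant_param_map:
  assumes inf: "infinite (UNIV :: 'k set)"
  shows "dominant_rational_map {..<num_params n} ({..<n} \<times> {..<n})
    (singular_matrices n :: (nat \<times> nat \<Rightarrow> 'k) set) (param_map n)"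
proof -
  let ?J = "{..<num_params n}" and ?I = "{..<n} \<times> {..<n}"
  let ?det = "perm_poly id n (perms n) :: (nat \<times> nat, 'k) laurent"
  let ?X = "singular_matrices n :: (nat \<times> nat \<Rightarrow> 'k) set"
  let ?Y = "ratmap_eval ?J ?I (param_map n) ` ratmap_domain ?J ?I (param_map n) :: (nat \<times> nat \<Rightarrow> 'k) set"
  have sub: "?Y \<subseteq> ?X"
    unfolding singular_matrices_eq_zero_locus
  proof (rule ratmap_image_subset_zero_locus[where N = "numer n" and H = "\<lambda>_. denom n", OF inf])
    fix x :: "nat \<Rightarrow> 'k" and f
    assume x: "x \<in> torus ?J" and f: "f \<in> {?det}"
      and nz: "\<forall>kl\<in>?I. laurent_eval (numer n kl) x \<noteq> 0 \<and> laurent_eval (denom n) x \<noteq> 0"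
    let ?y = "\<lambda>kl\<in>?I. laurent_eval (numer n kl) x / laurent_eval (denom n) x"
    \<comment> \<open>Some index is needed to extract from \<open>nz\<close> that the common
      denominator is non-zero.\<close>
    have "(0, 0) \<in> ?I" using n by auto
    then have "det (mat n n (\<lambda>kl. laurent_eval (numer n kl) x / laurent_eval (denom n) x)) = 0"
      using nz by (intro det_parametrized_matrix[OF x refl]) blast
    moreover have "mat n n ?y = mat n n (\<lambda>kl. laurent_eval (numer n kl) x / laurent_eval (denom n) x)"
      by (rule cong_mat) auto
    moreover have "?y \<in> torus ?I"
      unfolding torus_def using nz by (intro restrict_PiE_iff[THEN iffD2]) auto
    ultimately show "laurent_eval f ?y = 0"
      using f by (simp only: singletonD[OF f] laurent_eval_det)
  qed (use is_fraction_param_map numer_denom_neq_zero det_poly_in_laurent_polys in auto)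
  moreover have "zariski_closure ?I ?Y = ?X"
  proof
    have "?det \<in> vanishing_ideal ?I ?Y"
      using sub det_poly_in_laurent_polys
      unfolding vanishing_ideal_def singular_matrices_eq_zero_locus zero_locus_def by blast
    then show "zariski_closure ?I ?Y \<subseteq> ?X"
      unfolding singular_matrices_eq_zero_locus zariski_closure_def zero_locus_def by blast
    show "?X \<subseteq> zariski_closure ?I ?Y"
      unfolding zariski_closure_def zero_locus_def
    proof (intro subsetI CollectI conjI ballI)
      fix M f assume M: "M \<in> ?X" and "f \<in> vanishing_ideal ?I ?Y"
      then have "f \<in> laurent_polys ?I" "\<And>y. y \<in> ?Y \<Longrightarrow> laurent_eval f y = 0"
        by (auto simp: vanishing_ideal_def)
      then show "laurent_eval f M = 0"
        by (rule laurent_eval_singular_matrix[OF inf _ _ M]) (blast intro: mem_image_param_map[OF inf])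
    qed (simp add: singular_matrices_def)
  qed
  ultimately show ?thesis
    unfolding dominant_rational_map_def using rational_map_param_map by blast
qed

text \<open>Testing \<open>\<xi>\<close> against the determinant yields two optimal permutations; a
  row in which they differ selects the entry (i, j) and with it the weights \<open>\<zeta>\<close>
  mapped to \<open>\<xi>\<close>.\<close>

lemma trop_singular_matrices_subset:
  "trop_variety v ({..<n} \<times> {..<n}) (singular_matrices n :: (nat \<times> nat \<Rightarrow> 'k) set) \<subseteq>
    trop_map v {..<num_params n} ({..<n} \<times> {..<n}) (param_map n) ` ({..<num_params n} \<rightarrow>\<^sub>E UNIV)"
proof
  let ?J = "{..<num_params n}" and ?I = "{..<n} \<times> {..<n}"
  let ?det = "perm_poly id n (perms n) :: (nat \<times> nat, 'k) laurent"
  fix \<xi> assume \<xi>: "\<xi> \<in> trop_variety v ?I (singular_matrices n :: (nat \<times> nat \<Rightarrow> 'k) set)"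
  have keys: "Poly_Mapping.keys ?det = perm_expo id n ` perms n"
    by (rule keys_perm_poly) auto
  have "id \<in> perms n" by (simp add: permutes_id)
  then have "Poly_Mapping.keys ?det \<noteq> {}" unfolding keys by blast
  then have "?det \<noteq> 0" by (metis keys_zero)
  moreover have "?det \<in> vanishing_ideal ?I (singular_matrices n)"
    unfolding vanishing_ideal_def singular_matrices_eq_zero_locus
    using det_poly_in_laurent_polys by (auto simp: zero_locus_def)
  ultimately have "\<xi> \<in> corner_locus v ?I ?det" and \<xi>I: "\<xi> \<in> ?I \<rightarrow>\<^sub>E UNIV"
    using \<xi> by (auto simp: trop_variety_def)
  then obtain \<pi> \<sigma> where \<pi>: "\<pi> \<in> perms n" and \<sigma>: "\<sigma> \<in> perms n" and ne: "\<pi> \<noteq> \<sigma>"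
    and w: "term_weight v ?det \<xi> (perm_expo id n \<pi>) = trop_poly v ?det \<xi>"
      "term_weight v ?det \<xi> (perm_expo id n \<sigma>) = trop_poly v ?det \<xi>"
    unfolding corner_locus_def keys by blast
  define m where "m = trop_poly v ?det \<xi>"
  have weight: "term_weight v ?det \<xi> (perm_expo id n \<tau>) = perm_weight \<xi> n \<tau>" if "\<tau> \<in> perms n" for \<tau>
    using term_weight_perm_poly[OF v _ order_refl that, of id \<xi>] by simp
  have m: "perm_weight \<xi> n \<pi> = m" "perm_weight \<xi> n \<sigma> = m"
    using w weight[OF \<pi>] weight[OF \<sigma>] by (simp_all add: m_def)
  have min: "\<forall>\<tau>\<in>perms n. m \<le> perm_weight \<xi> n \<tau>"
    using weight unfolding m_def trop_poly_def keys
    by (auto intro!: Min_le finite_imageI finite_perms simp: image_iff)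
  obtain i where i: "\<pi> i \<noteq> \<sigma> i" using ne by blast
  have in_: "i < n"
  proof (rule ccontr)
    assume "\<not> i < n"
    then have "\<pi> i = i" "\<sigma> i = i" using \<pi> \<sigma> by (auto intro: permutes_not_in)
    then show False using i by simp
  qed
  \<comment> \<open>With this choice \<open>\<pi>\<close> uses the entry (i, j) and
    \<open>\<sigma>\<close> does not.\<close>
  define j where "j = \<pi> i"
  have jn: "j < n" unfolding j_def by (rule perms_less[OF \<pi> in_])
  \<comment> \<open>The least value that satisfies the gap condition for every entry.\<close>
  define L where "L = Max ((\<lambda>kl. 1 + \<xi> kl - \<xi> (i, j)) ` ?I)"
  have L: "\<forall>kl\<in>?I. 1 + \<xi> kl - \<xi> (i, j) \<le> L" unfolding L_def by (auto intro!: Max_ge)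
  obtain \<zeta> where \<zeta>J: "\<zeta> \<in> ?J \<rightarrow>\<^sub>E UNIV" and \<zeta>: "\<forall>kl\<in>?I. \<zeta> (entry_idx n kl) = \<xi> kl"
    "\<forall>k<n. \<zeta> (row_idx n k) = (if k = i then 0 else L)"
    "\<forall>l<n. \<zeta> (col_idx n l) = (if l = j then 0 else L)"
    using exists_params[of n \<xi> "\<lambda>k. if k = i then 0 else L" "\<lambda>l. if l = j then 0 else L"] by blast
  have "\<pi> \<in> perms_at n i j" "\<sigma> \<in> perms n - perms_at n i j"
    using \<pi> \<sigma> i by (auto simp: perms_at_def j_def)
  note trop = trop_poly_numer_denom(3)[OF v in_ jn \<zeta> L min this(1) m(1) this(2) m(2)]
  have "trop_map v ?J ?I (param_map n) \<zeta> = \<xi>"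
  proof
    fix kl show "trop_map v ?J ?I (param_map n) \<zeta> kl = \<xi> kl"
    proof (cases "kl \<in> ?I")
      case True
      then show ?thesis
        using trop_ratfun_eq[OF v is_fraction_param_map[OF True] numer_denom_neq_zero(1)[OF True]]
          trop[OF True] by (simp add: trop_map_def)
    next
      case False
      then show ?thesis using PiE_arb[OF \<xi>I] by (simp add: trop_map_def del: mem_Sigma_iff)
    qed
  qed
  then show "\<xi> \<in> trop_map v ?J ?I (param_map n) ` (?J \<rightarrow>\<^sub>E UNIV)"
    using \<zeta>J by (metis image_eqI)
qed

end

text \<open>From \<open>n \<ge> 2\<close> on the variety is non-empty, the all-ones matrix being
  singular, and a rational map from a torus can have it as its target.\<close>

theorem corollary4p5:
  fixes v :: "'k::alg_closed_field \<Rightarrow> ereal" and n :: nat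
  assumes "nonarch_valuation v"
    and "n \<ge> 2"
  shows "tropically_unirational v ({..<n} \<times> {..<n}) (singular_matrices n :: (nat \<times> nat \<Rightarrow> 'k) set)"
proof -
  let ?J = "{..<num_params n}" and ?I = "{..<n} \<times> {..<n}"
  let ?X = "singular_matrices n :: (nat \<times> nat \<Rightarrow> 'k) set"
  note inf = infinite_UNIV_alg_closed[where 'k = 'k]
  have dom: "dominant_rational_map ?J ?I ?X (param_map n)"
    by (rule dominant_param_map[OF assms inf])
  then have "rational_map ?J ?I (param_map n :: _ \<Rightarrow> (nat, 'k) laurent fract)"
    "ratmap_eval ?J ?I (param_map n) ` ratmap_domain ?J ?I (param_map n) \<subseteq> ?X"
    by (simp_all add: dominant_rational_map_def)
  then have "trop_map v ?J ?I (param_map n) ` (?J \<rightarrow>\<^sub>E UNIV) \<subseteq> trop_variety v ?I ?X"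
    by (intro image_subsetI trop_map_mem_trop_variety[OF assms(1) inf]) auto
  then have "trop_map v ?J ?I (param_map n) ` (?J \<rightarrow>\<^sub>E UNIV) = trop_variety v ?I ?X"
    using trop_singular_matrices_subset[OF assms] by blast
  moreover have "closed_subvariety ?I ?X"
    unfolding closed_subvariety_def singular_matrices_eq_zero_locus
    using det_poly_in_laurent_polys by blast
  ultimately show ?thesis
    unfolding tropically_unirational_def using dom by blast
qed

end
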